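(* Let $p,q\ge 0$ be integers and $n=p+q\geq 1$. The following subspaces of the complex Clifford algebra $\mathcal{C}\!\ell^{\mathbb C}(p,q)$ are closed with respect to the anticommutator $U,V\mapsto\{U,V\}=UV+VU$ and hence form subalgebras of the Clifford algebra considered with respect to this operation: 1.1–1.2) for $n\ge1$: $\widehat{\mathbf 0}$; $\ \widehat{\mathbf 0}\oplus i\widehat{\mathbf 0}$; 2.1–2.3) for $n\ge2$: $\widehat{\mathbf 0}\oplus\widehat{\mathbf 1}$; $\ \widehat{\mathbf 0}\oplus i\widehat{\mathbf 1}$; $\ \widehat{\mathbf 0}\oplus\widehat{\mathbf 1}\oplus i\widehat{\mathbf 0}\oplus i\widehat{\mathbf 1}$; 3.1–3.3) for $n\ge2$: $\widehat{\mathbf 0}\oplus\widehat{\mathbf n}$; $\ \widehat{\mathbf 0}\oplus i\widehat{\mathbf n}$; $\ \widehat{\mathbf 0}\oplus\widehat{\mathbf n}\oplus i\widehat{\mathbf 0}\oplus i\widehat{\mathbf n}$; 4.1–4.3) for $n\ge3$: $\widehat{\mathbf 0}\oplus\widehat{\mathbf{n-1}}$; $\ \widehat{\mathbf 0}\oplus i\widehat{\mathbf{n-1}}$; $\ \widehat{\mathbf 0}\oplus\widehat{\mathbf{n-1}}\oplus i\widehat{\mathbf 0}\oplus i\widehat{\mathbf{n-1}}$; 5.1–5.5) for even $n\ge4$: $\widehat{\mathbf 0}\oplus\widehat{\mathbf 1}\oplus\widehat{\mathbf n}$; $\ \widehat{\mathbf 0}\oplus i\widehat{\mathbf 1}\oplus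 i\widehat{\mathbf n}$; $\ \widehat{\mathbf 0}\oplus i\widehat{\mathbf 1}\oplus\widehat{\mathbf n}$; $\ \widehat{\mathbf 0}\oplus\widehat{\mathbf 1}\oplus i\widehat{\mathbf n}$; $\ \widehat{\mathbf 0}\oplus\widehat{\mathbf 1}\oplus\widehat{\mathbf n}\oplus i\widehat{\mathbf 0}\oplus i\widehat{\mathbf 1}\oplus i\widehat{\mathbf n}$; 6.1–6.5) for even $n\ge4$: $\widehat{\mathbf 0}\oplus\widehat{\mathbf{n-1}}\oplus\widehat{\mathbf n}$; $\ \widehat{\mathbf 0}\oplus i\widehat{\mathbf{n-1}}\oplus i\widehat{\mathbf n}$; $\ \widehat{\mathbf 0}\oplus i\widehat{\mathbf{n-1}}\oplus\widehat{\mathbf n}$; $\ \widehat{\mathbf 0}\oplus\widehat{\mathbf{n-1}}\oplus i\widehat{\mathbf n}$; $\ \widehat{\mathbf 0}\oplus\widehat{\mathbf{n-1}}\oplus\widehat{\mathbf n}\oplus i\widehat{\mathbf 0}\oplus i\widehat{\mathbf{n-1}}\oplus i\widehat{\mathbf n}$; 7.1–7.3) for $n\ge4$ (if $n=1$ it is the same as item 1, if $n=2$ as item 3, if $n=3$ as item 4), with all even ranks up to the even number $k$, where $n=k,k+1$: $\widehat{\mathbf 0}\oplus\widehat{\mathbf 2}\oplus\widehat{\mathbf 4}\oplus\ldots\oplus\widehat{\mathbf k}=\overline{\mathbf{02}}$; $\ \widehat{\mathbf 0}\oplus i\widehat{\mathbf 2}\oplus\widehat{\mathbf 4}\oplus i\widehat{\mathbf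 6}\oplus\ldots\oplus i a_k\widehat{\mathbf k}=\overline{\mathbf 0}\oplus i\,\overline{\mathbf 2}$; $\ \widehat{\mathbf 0}\oplus\widehat{\mathbf 2}\oplus\ldots\oplus\widehat{\mathbf k}\oplus i\widehat{\mathbf 0}\oplus i\widehat{\mathbf 2}\oplus\ldots\oplus i\widehat{\mathbf k}=\overline{\mathbf{02}}\oplus i\,\overline{\mathbf{02}}$; 8.1–8.5) for odd $n\ge5$: $\widehat{\mathbf 0}\oplus\widehat{\mathbf 1}\oplus\widehat{\mathbf{n-1}}\oplus\widehat{\mathbf n}$; $\ \widehat{\mathbf 0}\oplus\widehat{\mathbf 1}\oplus i\widehat{\mathbf{n-1}}\oplus i\widehat{\mathbf n}$; $\ \widehat{\mathbf 0}\oplus i\widehat{\mathbf 1}\oplus i\widehat{\mathbf{n-1}}\oplus\widehat{\mathbf n}$; $\ \widehat{\mathbf 0}\oplus i\widehat{\mathbf 1}\oplus\widehat{\mathbf{n-1}}\oplus i\widehat{\mathbf n}$; $\ \widehat{\mathbf 0}\oplus\widehat{\mathbf 1}\oplus\widehat{\mathbf{n-1}}\oplus\widehat{\mathbf n}\oplus i\widehat{\mathbf 0}\oplus i\widehat{\mathbf 1}\oplus i\widehat{\mathbf{n-1}}\oplus i\widehat{\mathbf n}$; 9.1–9.3) for $n\ge5$ (if $n=1,2$ it is the same as item 1, if $n=3$ as item 3, if $n=4$ as item 6), with all ranks $\equiv0,3\pmod4$ up to $k$, where $n=k,k+1,k+2$ for even $k$ and $n=k$ for odd $k$: $\widehat{\mathbf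 0}\oplus\widehat{\mathbf 3}\oplus\widehat{\mathbf 4}\oplus\widehat{\mathbf 7}\oplus\ldots\oplus\widehat{\mathbf k}=\overline{\mathbf{03}}$; $\ \widehat{\mathbf 0}\oplus i\widehat{\mathbf 3}\oplus\widehat{\mathbf 4}\oplus i\widehat{\mathbf 7}\oplus\ldots\oplus i a_k\widehat{\mathbf k}=\overline{\mathbf 0}\oplus i\,\overline{\mathbf 3}$; $\ \widehat{\mathbf 0}\oplus\widehat{\mathbf 3}\oplus\widehat{\mathbf 4}\oplus\widehat{\mathbf 7}\oplus\ldots\oplus\widehat{\mathbf k}\oplus i\widehat{\mathbf 0}\oplus i\widehat{\mathbf 3}\oplus i\widehat{\mathbf 4}\oplus i\widehat{\mathbf 7}\oplus\ldots\oplus i\widehat{\mathbf k}=\overline{\mathbf{03}}\oplus i\,\overline{\mathbf{03}}$; 10.1–10.3) for $n\ge6$ (if $n=2,3$ it is the same as item 2, if $n=4$ as item 5, if $n=5$ as item 8), with all ranks $\equiv0,1\pmod4$ up to $k$, where $n=k,k+1,k+2$ for odd $k$ and $n=k$ for even $k$: $\widehat{\mathbf 0}\oplus\widehat{\mathbf 1}\oplus\widehat{\mathbf 4}\oplus\widehat{\mathbf 5}\oplus\ldots\oplus\widehat{\mathbf k}=\overline{\mathbf{01}}$; $\ \widehat{\mathbf 0}\oplus i\widehat{\mathbf 1}\oplus\widehat{\mathbf 4}\oplus i\widehat{\mathbf 5}\oplus\ldots\oplus a_{k-1}\widehat{\mathbf k}=\overline{\mathbf 0}\oplus i\,\overline{\mathbf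 1}$; $\ \widehat{\mathbf 0}\oplus\widehat{\mathbf 1}\oplus\widehat{\mathbf 4}\oplus\widehat{\mathbf 5}\oplus\ldots\oplus\widehat{\mathbf k}\oplus i\widehat{\mathbf 0}\oplus i\widehat{\mathbf 1}\oplus i\widehat{\mathbf 4}\oplus i\widehat{\mathbf 5}\oplus\ldots\oplus i\widehat{\mathbf k}=\overline{\mathbf{01}}\oplus i\,\overline{\mathbf{01}}$; 11.1–11.2) for $n\ge6$ (if $n=1,2,3$ it is the same as item 1, if $n=4$ as item 3, if $n=5$ as item 4), with all ranks $\equiv0\pmod4$ up to $k\equiv 0\pmod 4$, where $n=k,k+1,k+2,k+3$: $\widehat{\mathbf 0}\oplus\widehat{\mathbf 4}\oplus\widehat{\mathbf 8}\oplus\ldots\oplus\widehat{\mathbf k}=\overline{\mathbf 0}$; $\ \widehat{\mathbf 0}\oplus\widehat{\mathbf 4}\oplus\ldots\oplus\widehat{\mathbf k}\oplus i\widehat{\mathbf 0}\oplus i\widehat{\mathbf 4}\oplus\ldots\oplus i\widehat{\mathbf k}=\overline{\mathbf 0}\oplus i\,\overline{\mathbf 0}$; 12.1–12.4) for $n\ge2$: $\widehat{\mathbf 0}\oplus\widehat{\mathbf 1}\oplus\widehat{\mathbf 2}\oplus\ldots\oplus\widehat{\mathbf n}=\overline{\mathbf{0123}}$; $\ \widehat{\mathbf 0}\oplus\widehat{\mathbf 1}\oplus i\widehat{\mathbf 2}\oplus\ldots\oplus i a_n\widehat{\mathbf n}=\overline{\mathbf{01}}\oplus i\,\overline{\mathbf{23}}$;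 $\ \widehat{\mathbf 0}\oplus i\widehat{\mathbf 1}\oplus\widehat{\mathbf 2}\oplus\ldots\oplus i^n(-1)^{n(n-1)/2}\widehat{\mathbf n}=\overline{\mathbf{02}}\oplus i\,\overline{\mathbf{13}}$; $\ \widehat{\mathbf 0}\oplus i\widehat{\mathbf 1}\oplus i\widehat{\mathbf 2}\oplus\ldots\oplus a_{n-1}\widehat{\mathbf n}=\overline{\mathbf{03}}\oplus i\,\overline{\mathbf{12}}$.
   Context: $\mathcal{C}\!\ell^{\mathbb F}(p,q)$ ($\mathbb F=\mathbb R$ or $\mathbb C$) is the Clifford algebra over $\mathbb F$ with identity $e$ and generators $e^1,\dots,e^n$, $n=p+q$, satisfying $e^ae^b+e^be^a=2\eta^{ab}e$, where $\eta$ is diagonal with $p$ entries $+1$ followed by $q$ entries $-1$. The $2^n$ elements $e$ and $e^{a_1\ldots a_k}=e^{a_1}\cdots e^{a_k}$ ($a_1<\dots<a_k$, $1\le k\le n$) form an $\mathbb F$-basis. We regard $\mathcal{C}\!\ell^{\mathbb R}(p,q)\subset\mathcal{C}\!\ell^{\mathbb C}(p,q)=\mathcal{C}\!\ell^{\mathbb R}(p,q)\oplus i\,\mathcal{C}\!\ell^{\mathbb R}(p,q)$. $\widehat{\mathbf k}=\mathcal{C}\!\ell^{\mathbb R}_k(p,q)$ is the real span of the basis elements with $k$ indices (rank $k$; $\widehat{\mathbf 0}=\mathbb R e$). For a nonzero scalar $c$, $c\,\widehat{\mathbf k}=\{cU:U\in\widehat{\mathbf k}\}$ (so a sign is irrelevant,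 e.g. $i\cdot i\,\widehat{\mathbf k}=\widehat{\mathbf k}$). The coefficients are $a_k=1$ for $k\equiv2,3\pmod4$ and $a_k=i$ for $k\equiv0,1\pmod4$. For $k\in\{0,1,2,3\}$, $\overline{\mathbf k}=\bigoplus_{j\equiv k\,(\mathrm{mod}\,4),\,0\le j\le n}\widehat{\mathbf j}$, $\overline{\mathbf{kl}}=\overline{\mathbf k}\oplus\overline{\mathbf l}$, $\overline{\mathbf{0123}}=\mathcal{C}\!\ell^{\mathbb R}(p,q)$. Subspaces and subalgebras are understood over $\mathbb R$. *)

theory Defs
  imports Complex_Main "HOL-Library.Set_Algebras" "HOL-Library.Cardinality"
begin

definition signature :: "nat \<Rightarrow> nat \<Rightarrow> nat \<Rightarrow> complex" where
  "signature p a b = (if a \<noteq> b then 0 else if a \<le> p then 1 else -1)"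

definition anticommutator :: "'a::ring \<Rightarrow> 'a \<Rightarrow> 'a" where
  "anticommutator U V = U * V + V * U"

text \<open>A Clifford algebra is characterised here by its defining properties rather than by a
  particular construction; generators are indexed by \<open>1, \<dots>, p + q\<close>, and \<open>gen\<close> is unconstrained
  elsewhere.  Models for all \<open>p\<close>, \<open>q\<close> are constructed at the end of this theory.\<close>

locale complex_clifford_algebra = vector_space scale
  for scale :: "complex \<Rightarrow> 'a::ring_1 \<Rightarrow> 'a" (infixr \<open>*\<^sub>C\<close> 75) +
  fixes gen :: "nat \<Rightarrow> 'a" and p q :: nat
  assumes scale_mult_left: "(c *\<^sub>C x) * y = c *\<^sub>C (x * y)"
    and scale_mult_right: "x * (c *\<^sub>C y) = c *\<^sub>C (x * y)"
    and gen_anticommute: "\<lbrakk>a \<in> {1..p + q}; b \<in> {1..p + q}\<rbrakk> \<Longrightarrow>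
      gen a * gen b + gen b * gen a = (2 * signature p a b) *\<^sub>C 1"
    and inj_on_blades:
      "inj_on (\<lambda>A. prod_list (map gen (sorted_list_of_set A))) (Pow {1..p + q})"
    and independent_blades:
      "independent ((\<lambda>A. prod_list (map gen (sorted_list_of_set A))) ` Pow {1..p + q})"
    and span_blades:
      "span ((\<lambda>A. prod_list (map gen (sorted_list_of_set A))) ` Pow {1..p + q}) = UNIV"
begin

definition blade :: "nat set \<Rightarrow> 'a" where
  "blade A = prod_list (map gen (sorted_list_of_set A))"

sublocale real: vector_space "\<lambda>r x. complex_of_real r *\<^sub>C x"
  by unfold_locales (simp_all add: algebra_simps)

definition real_clifford :: "'a set" where
  "real_clifford = real.span (blade ` Pow {1..p + q})"

definition rank_space :: "nat \<Rightarrow> 'a set" where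
  "rank_space k = real.span (blade ` {A. A \<subseteq> {1..p + q} \<and> card A = k})"

text \<open>The sum of a family of sets is the elementwise (Minkowski) sum, the empty sum being \<open>{0}\<close>.\<close>

definition quaternion_type :: "nat \<Rightarrow> 'a set" where
  "quaternion_type k = (\<Sum>j | j \<le> p + q \<and> j mod 4 = k. rank_space j)"

definition anticommutator_subalgebra :: "'a set \<Rightarrow> bool" where
  "anticommutator_subalgebra S \<longleftrightarrow>
     real.subspace S \<and> (\<forall>U\<in>S. \<forall>V\<in>S. anticommutator U V \<in> S)"

end

definition direct_sum :: "'a::comm_monoid_add set list \<Rightarrow> bool" where
  "direct_sum Ws \<longleftrightarrow>
     (\<forall>us. list_all2 (\<in>) us Ws \<longrightarrow> sum_list us = 0 \<longrightarrow> (\<forall>u\<in>set us. u = 0))"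

text \<open>The argument is an integer so that \<open>rank_coeff (k - 1)\<close> also makes sense for \<open>k = 0\<close>.\<close>

definition rank_coeff :: "int \<Rightarrow> complex" where
  "rank_coeff k = (if k mod 4 \<in> {2, 3} then 1 else \<i>)"


subsection \<open>Existence\<close>

text \<open>The Clifford algebra as a twisted group algebra of the finite subsets of the index set under
  symmetric difference.  The number of positive (negative) generators is \<open>CARD('p) - 1\<close>
  (\<open>CARD('q) - 1\<close>), so that every pair of natural numbers occurs.\<close>

definition gen_sign :: "nat \<Rightarrow> nat \<Rightarrow> nat \<Rightarrow> complex" where
  "gen_sign p a b = (if a < b then 1 else if b < a then -1 else signature p a a)"

definition blade_sign :: "nat \<Rightarrow> nat set \<Rightarrow> nat set \<Rightarrow> complex" where
  "blade_sign p A B = (\<Prod>a\<in>A. \<Prod>b\<in>B. gen_sign p a b)"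

lemma gen_sign_square: "gen_sign p a b * gen_sign p a b = 1"
  by (simp add: gen_sign_def signature_def)

lemma prod_sym_diff:
  fixes f :: "'b \<Rightarrow> complex"
  assumes "finite A" "finite B" and sq: "\<And>x. f x * f x = 1"
  shows "prod f (sym_diff A B) = prod f A * prod f B"
proof -
  have 1: "prod f A = prod f (A - B) * prod f (A \<inter> B)"
    using prod.union_disjoint[of "A - B" "A \<inter> B" f] assms
    by (metis Diff_disjoint Int_Diff Int_commute Un_Diff_Int finite_Diff finite_Int)
  have 2: "prod f B = prod f (B - A) * prod f (A \<inter> B)"
    using prod.union_disjoint[of "B - A" "A \<inter> B" f] assms
    by (metis Diff_disjoint Int_Diff Int_commute Un_Diff_Int finite_Diff finite_Int)
  have 3: "prod f (A \<inter> B) * prod f (A \<inter> B) = 1"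
    by (simp add: sq flip: prod.distrib)
  have "prod f (sym_diff A B) = prod f (A - B) * prod f (B - A)"
    using assms by (intro prod.union_disjoint) auto
  also have "\<dots> = prod f A * prod f B"
    unfolding 1 2 using 3 by (simp add: mult.assoc mult.left_commute)
  finally show ?thesis .
qed

lemma blade_sign_sym_diff_left:
  assumes "finite A" "finite A'"
  shows "blade_sign p (sym_diff A A') B = blade_sign p A B * blade_sign p A' B"
  unfolding blade_sign_def using assms
  by (intro prod_sym_diff) (simp_all add: gen_sign_square flip: prod.distrib)

lemma blade_sign_sym_diff_right:
  assumes "finite B" "finite B'"
  shows "blade_sign p A (sym_diff B B') = blade_sign p A B * blade_sign p A B'"
  unfolding blade_sign_def using assms
  by (simp add: prod_sym_diff gen_sign_square prod.distrib)

lemma sym_diff_not_subset: "\<lbrakk>A \<subseteq> N; \<not> C \<subseteq> N\<rbrakk> \<Longrightarrow> \<not> sym_diff A C \<subseteq> N"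
  by blast

definition model_dim :: "'p::finite itself \<Rightarrow> 'q::finite itself \<Rightarrow> nat" where
  "model_dim _ _ = (CARD('p) - 1) + (CARD('q) - 1)"

typedef ('p::finite, 'q::finite) clifford_model =
  "{f :: nat set \<Rightarrow> complex. \<forall>A. \<not> A \<subseteq> {1..model_dim TYPE('p) TYPE('q)} \<longrightarrow> f A = 0}"
  by (rule exI[of _ "\<lambda>_. 0"]) simp

setup_lifting type_definition_clifford_model

instantiation clifford_model :: (finite, finite) ring_1
begin

lift_definition zero_clifford_model :: "('a, 'b) clifford_model" is "\<lambda>_. 0" by simp

lift_definition one_clifford_model :: "('a, 'b) clifford_model"
  is "\<lambda>A. if A = {} then 1 else 0" by auto

lift_definition plus_clifford_model ::
  "('a, 'b) clifford_model \<Rightarrow> ('a, 'b) clifford_model \<Rightarrow> ('a, 'b) clifford_model"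
  is "\<lambda>f g A. f A + g A" by simp

lift_definition minus_clifford_model ::
  "('a, 'b) clifford_model \<Rightarrow> ('a, 'b) clifford_model \<Rightarrow> ('a, 'b) clifford_model"
  is "\<lambda>f g A. f A - g A" by simp

lift_definition uminus_clifford_model :: "('a, 'b) clifford_model \<Rightarrow> ('a, 'b) clifford_model"
  is "\<lambda>f A. - f A" by simp

lift_definition times_clifford_model ::
  "('a, 'b) clifford_model \<Rightarrow> ('a, 'b) clifford_model \<Rightarrow> ('a, 'b) clifford_model"
  is "\<lambda>f g C. \<Sum>A\<in>Pow {1..model_dim TYPE('a) TYPE('b)}.
        blade_sign (CARD('a) - 1) A (sym_diff A C) * f A * g (sym_diff A C)"
  by (intro allI impI sum.neutral ballI)
    (metis Pow_iff mult_zero_right sym_diff_not_subset)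

instance
proof
  fix x y z :: "('a, 'b) clifford_model"
  let ?s = "blade_sign (CARD('a) - 1)" and ?N = "{1..model_dim TYPE('a) TYPE('b)}"
  show "x + y + z = x + (y + z)" by transfer (simp add: add.assoc)
  show "x + y = y + x" by transfer (simp add: add.commute)
  show "0 + x = x" by transfer simp
  show "- x + x = 0" by transfer simp
  show "x - y = x + - y" by transfer simp
  show "(x + y) * z = x * z + y * z"
    by transfer (simp add: algebra_simps sum.distrib)
  show "x * (y + z) = x * y + x * z"
    by transfer (simp add: algebra_simps sum.distrib)
  show "(0::('a, 'b) clifford_model) \<noteq> 1" by transfer (auto dest!: fun_cong[where x = "{}"])
  show "1 * x = x"
  proof (transfer, rule ext)
    fix f :: "nat set \<Rightarrow> complex" and C
    have "(\<Sum>A\<in>Pow ?N. ?s A (sym_diff A C) * (if A = {} then 1 else 0) * f (sym_diff A C))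
        = (\<Sum>A\<in>Pow ?N. if A = {} then f C else 0)"
      by (intro sum.cong) (auto simp: blade_sign_def)
    also have "\<dots> = f C" by (subst sum.delta) auto
    finally show "(\<Sum>A\<in>Pow ?N. ?s A (sym_diff A C) * (if A = {} then 1 else 0)
        * f (sym_diff A C)) = f C" .
  qed
  show "x * 1 = x"
  proof (transfer, rule ext)
    fix f :: "nat set \<Rightarrow> complex" and C
    assume f: "\<forall>A. \<not> A \<subseteq> ?N \<longrightarrow> f A = 0"
    have "(\<Sum>A\<in>Pow ?N. ?s A (sym_diff A C) * f A * (if sym_diff A C = {} then 1 else 0))
        = (\<Sum>A\<in>Pow ?N. if A = C then f C else 0)"
    proof (intro sum.cong refl)
      fix A
      have "sym_diff A C = {} \<longleftrightarrow> A = C" by blast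
      then show "?s A (sym_diff A C) * f A * (if sym_diff A C = {} then 1 else 0)
          = (if A = C then f C else 0)"
        by (auto simp: blade_sign_def)
    qed
    also have "\<dots> = f C" using f by (subst sum.delta) auto
    finally show "(\<Sum>A\<in>Pow ?N. ?s A (sym_diff A C) * f A
        * (if sym_diff A C = {} then 1 else 0)) = f C" .
  qed
  show "x * y * z = x * (y * z)"
  proof (transfer, rule ext)
    fix f g h :: "nat set \<Rightarrow> complex" and C
    assume h: "\<forall>A. \<not> A \<subseteq> ?N \<longrightarrow> h A = 0"
    have step: "(\<Sum>A\<in>Pow ?N. ?s A (sym_diff A C) * (?s B (sym_diff B A) * f B * g (sym_diff B A))
            * h (sym_diff A C))
        = ?s B (sym_diff B C) * f B * (\<Sum>D\<in>Pow ?N. ?s D (sym_diff D (sym_diff B C)) * g D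
            * h (sym_diff D (sym_diff B C)))" if B: "B \<in> Pow ?N" for B
    proof -
      have bij: "bij_betw (sym_diff B) (Pow ?N) (Pow ?N)"
        by (rule bij_betw_byWitness[where f' = "sym_diff B"]) (use B in blast)+
      have "(\<Sum>A\<in>Pow ?N. ?s A (sym_diff A C) * (?s B (sym_diff B A) * f B * g (sym_diff B A))
            * h (sym_diff A C))
          = (\<Sum>D\<in>Pow ?N. ?s (sym_diff B D) (sym_diff (sym_diff B D) C) *
            (?s B (sym_diff B (sym_diff B D)) * f B * g (sym_diff B (sym_diff B D)))
            * h (sym_diff (sym_diff B D) C))"
        by (rule sum.reindex_bij_betw[OF bij, symmetric])
      also have "\<dots> = (\<Sum>D\<in>Pow ?N. ?s B (sym_diff B C) * f B *
          (?s D (sym_diff D (sym_diff B C)) * g D * h (sym_diff D (sym_diff B C))))"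
      proof (intro sum.cong refl)
        fix D assume D: "D \<in> Pow ?N"
        let ?E = "sym_diff D (sym_diff B C)"
        have e: "sym_diff (sym_diff B D) C = ?E" "sym_diff B (sym_diff B D) = D" by blast+
        show "?s (sym_diff B D) (sym_diff (sym_diff B D) C) *
            (?s B (sym_diff B (sym_diff B D)) * f B * g (sym_diff B (sym_diff B D)))
            * h (sym_diff (sym_diff B D) C)
          = ?s B (sym_diff B C) * f B * (?s D ?E * g D * h ?E)"
        proof (cases "?E \<subseteq> ?N")
          case False
          then show ?thesis unfolding e using h by simp
        next
          case True
          have fin: "finite B" "finite D" "finite ?E"
            using B D True finite_subset[of _ ?N] by blast+
          have "sym_diff B C = sym_diff D ?E" by blast
          then have "?s B (sym_diff B C) = ?s B D * ?s B ?E"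
            using blade_sign_sym_diff_right[OF fin(2,3), of _ B] by metis
          moreover have "?s (sym_diff B D) ?E = ?s B ?E * ?s D ?E"
            using fin by (simp only: blade_sign_sym_diff_left)
          ultimately show ?thesis unfolding e by (simp only: mult_ac)
        qed
      qed
      finally show ?thesis by (simp only: sum_distrib_left)
    qed
    have "(\<Sum>A\<in>Pow ?N. ?s A (sym_diff A C)
          * (\<Sum>B\<in>Pow ?N. ?s B (sym_diff B A) * f B * g (sym_diff B A)) * h (sym_diff A C))
        = (\<Sum>B\<in>Pow ?N. \<Sum>A\<in>Pow ?N. ?s A (sym_diff A C)
          * (?s B (sym_diff B A) * f B * g (sym_diff B A)) * h (sym_diff A C))"
      by (simp only: sum_distrib_left sum_distrib_right) (rule sum.swap)
    also have "\<dots> = (\<Sum>B\<in>Pow ?N. ?s B (sym_diff B C) * f B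
          * (\<Sum>D\<in>Pow ?N. ?s D (sym_diff D (sym_diff B C)) * g D * h (sym_diff D (sym_diff B C))))"
      by (intro sum.cong refl step)
    finally show "(\<Sum>A\<in>Pow ?N. ?s A (sym_diff A C)
          * (\<Sum>B\<in>Pow ?N. ?s B (sym_diff B A) * f B * g (sym_diff B A)) * h (sym_diff A C))
        = (\<Sum>B\<in>Pow ?N. ?s B (sym_diff B C) * f B
          * (\<Sum>D\<in>Pow ?N. ?s D (sym_diff D (sym_diff B C)) * g D * h (sym_diff D (sym_diff B C))))" .
  qed
qed

end

lift_definition model_scale ::
  "complex \<Rightarrow> ('p::finite, 'q::finite) clifford_model \<Rightarrow> ('p, 'q) clifford_model"
  is "\<lambda>c f A. c * f A" by simp

lift_definition model_blade :: "nat set \<Rightarrow> ('p::finite, 'q::finite) clifford_model"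
  is "\<lambda>B A. if A = B \<and> A \<subseteq> {1..model_dim TYPE('p) TYPE('q)} then 1 else 0" by auto

lemma model_blade_mult:
  assumes A: "A \<subseteq> {1..model_dim TYPE('p) TYPE('q)}" and B: "B \<subseteq> {1..model_dim TYPE('p) TYPE('q)}"
  shows "(model_blade A * model_blade B :: ('p::finite, 'q::finite) clifford_model)
    = model_scale (blade_sign (CARD('p) - 1) A B) (model_blade (sym_diff A B))"
  using assms
proof (transfer, intro ext)
  fix A B C :: "nat set"
  let ?N = "{1..model_dim TYPE('p) TYPE('q)}" and ?s = "blade_sign (CARD('p) - 1)"
  assume A: "A \<subseteq> ?N" and B: "B \<subseteq> ?N"
  have "(\<Sum>A'\<in>Pow ?N. ?s A' (sym_diff A' C) * (if A' = A \<and> A' \<subseteq> ?N then 1 else 0) *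
          (if sym_diff A' C = B \<and> sym_diff A' C \<subseteq> ?N then 1 else 0))
      = (\<Sum>A'\<in>Pow ?N. if A' = A then ?s A (sym_diff A C) * (if sym_diff A C = B then 1 else 0) else 0)"
    using A B by (intro sum.cong refl) auto
  also have "\<dots> = ?s A (sym_diff A C) * (if sym_diff A C = B then 1 else 0)"
    using A by (subst sum.delta) auto
  also have "\<dots> = ?s A B * (if C = sym_diff A B \<and> C \<subseteq> ?N then 1 else 0)"
  proof -
    have "sym_diff A C = B \<longleftrightarrow> C = sym_diff A B \<and> C \<subseteq> ?N" using A B by blast
    then show ?thesis by auto
  qed
  finally show "(\<Sum>A'\<in>Pow ?N. ?s A' (sym_diff A' C) * (if A' = A \<and> A' \<subseteq> ?N then 1 else 0) *
          (if sym_diff A' C = B \<and> sym_diff A' C \<subseteq> ?N then 1 else 0))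
      = ?s A B * (if C = sym_diff A B \<and> C \<subseteq> ?N then 1 else 0)" .
qed

lemma model_blade_eq_prod_list:
  assumes "A \<subseteq> {1..model_dim TYPE('p) TYPE('q)}"
  shows "prod_list (map (\<lambda>a. model_blade {a}) (sorted_list_of_set A))
    = (model_blade A :: ('p::finite, 'q::finite) clifford_model)"
proof -
  have "finite A" using assms finite_subset by blast
  then show ?thesis using assms
  proof (induction A rule: finite_linorder_min_induct)
    case empty
    show ?case by simp (transfer, auto)
  next
    case (insert b A)
    have "sorted_list_of_set (set (b # sorted_list_of_set A)) = b # sorted_list_of_set A"
      using insert.hyps
      by (intro sorted_list_of_set.idem_if_sorted_distinct) (auto simp: less_imp_le)
    then have "sorted_list_of_set (insert b A) = b # sorted_list_of_set A"
      using insert.hyps by simp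
    moreover have "sym_diff {b} A = insert b A" using insert.hyps by blast
    moreover have "blade_sign (CARD('p) - 1) {b} A = 1"
      using insert.hyps by (simp add: blade_sign_def gen_sign_def)
    moreover have "model_scale 1 x = x" for x :: "('p, 'q) clifford_model"
      by transfer simp
    ultimately show ?case
      using insert by (simp add: model_blade_mult)
  qed
qed

theorem clifford_algebra_exists:
  "complex_clifford_algebra
     (model_scale :: complex \<Rightarrow> ('p::finite, 'q::finite) clifford_model \<Rightarrow> _)
     (\<lambda>a. model_blade {a}) (CARD('p) - 1) (CARD('q) - 1)"
proof -
  let ?scale = "model_scale :: complex \<Rightarrow> ('p, 'q) clifford_model \<Rightarrow> _"
  let ?N = "{1..(CARD('p) - 1) + (CARD('q) - 1)}"
  interpret vector_space ?scale
    by unfold_locales (transfer; simp add: algebra_simps)+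
  have N: "{1..model_dim TYPE('p) TYPE('q)} = ?N" by (simp add: model_dim_def)
  have img: "prod_list (map (\<lambda>a. model_blade {a} :: ('p, 'q) clifford_model)
      (sorted_list_of_set A)) = model_blade A" if "A \<in> Pow ?N" for A
    using that model_blade_eq_prod_list[of A, where 'p = 'p and 'q = 'q]
    by (simp only: N Pow_iff)
  have inj: "inj_on (model_blade :: _ \<Rightarrow> ('p, 'q) clifford_model) (Pow ?N)"
    unfolding N[symmetric] inj_on_def by transfer (auto dest!: fun_cong split: if_splits)
  have imgs: "(\<lambda>A. prod_list (map (\<lambda>a. model_blade {a} :: ('p, 'q) clifford_model)
      (sorted_list_of_set A))) ` Pow ?N = model_blade ` Pow ?N"
    using img by (rule image_cong[OF refl])
  have coeff: "Rep_clifford_model (\<Sum>A\<in>S. ?scale (u A) (model_blade A)) B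
      = (if B \<in> S \<and> B \<in> Pow ?N then u B else 0)" if "finite S" for S u B
    using that
    by (induction S)
      (auto simp: zero_clifford_model.rep_eq plus_clifford_model.rep_eq model_scale.rep_eq
        model_blade.rep_eq model_dim_def)
  have expand: "x = (\<Sum>A\<in>Pow ?N. ?scale (Rep_clifford_model x A) (model_blade A))" for x
  proof -
    have "Rep_clifford_model x B = 0" if "\<not> B \<subseteq> ?N" for B
      using Rep_clifford_model[of x] that by (simp add: model_dim_def)
    then show ?thesis
      by (auto simp: coeff simp flip: Rep_clifford_model_inject)
  qed
  show ?thesis
  proof (unfold_locales, goal_cases)
    case (1 c x y)
    show ?case by transfer (simp add: sum_distrib_left mult_ac)
  next
    case (2 x c y)
    show ?case by transfer (simp add: sum_distrib_left mult_ac)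
  next
    case (3 a b)
    have 0: "model_blade {} = (1 :: ('p, 'q) clifford_model)" by transfer auto
    have *: "blade_sign k {i} {j} = gen_sign k i j" for i j k by (simp add: blade_sign_def)
    show ?case
    proof (cases "a = b")
      case True
      with 3 have "model_blade {a} * model_blade {b}
          = ?scale (signature (CARD('p) - 1) a b) (1 :: ('p, 'q) clifford_model)"
        by (simp add: model_blade_mult model_dim_def * 0 gen_sign_def)
      with True show ?thesis by (simp add: scale_left_distrib[symmetric])
    next
      case False
      moreover have "model_blade {b} * model_blade {a}
          = ?scale (gen_sign (CARD('p) - 1) b a) (model_blade (sym_diff {a} {b}))"
        using 3 by (simp add: model_blade_mult model_dim_def * Un_commute)
      moreover have "model_blade {a} * model_blade {b}
          = ?scale (gen_sign (CARD('p) - 1) a b) (model_blade (sym_diff {a} {b}))"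
        using 3 by (simp add: model_blade_mult model_dim_def *)
      ultimately show ?thesis
        by (simp add: signature_def gen_sign_def scale_left_distrib[symmetric])
    qed
  next
    case 4
    show ?case using inj by (subst inj_on_cong[OF img])
  next
    case 5
    have "independent (model_blade ` Pow ?N :: ('p, 'q) clifford_model set)"
    proof (subst independent_explicit_finite_subsets, intro allI impI ballI)
      fix S :: "('p, 'q) clifford_model set" and u v
      assume S: "S \<subseteq> model_blade ` Pow ?N" "finite S" and 0: "(\<Sum>v\<in>S. ?scale (u v) v) = 0"
        and v: "v \<in> S"
      obtain T where T: "T \<subseteq> Pow ?N" "S = model_blade ` T"
        using S by (meson subset_imageE)
      have "finite T" using T finite_subset by blast
      have injT: "inj_on (model_blade :: _ \<Rightarrow> ('p, 'q) clifford_model) T"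
        using inj T inj_on_subset by blast
      obtain B where B: "B \<in> T" "v = model_blade B" using v T by blast
      have "(\<Sum>A\<in>T. ?scale (u (model_blade A)) (model_blade A)) = 0"
        using 0 unfolding T by (simp add: sum.reindex[OF injT])
      then have "Rep_clifford_model (\<Sum>A\<in>T. ?scale (u (model_blade A)) (model_blade A)) B = 0"
        by (simp add: zero_clifford_model.rep_eq)
      then show "u v = 0" using B T \<open>finite T\<close> by (simp add: coeff subset_iff)
    qed
    then show ?case unfolding imgs by simp
  next
    case 6
    have "x \<in> span (model_blade ` Pow ?N)" for x :: "('p, 'q) clifford_model"
      by (subst expand) (intro span_sum span_scale span_base imageI)
    then show ?case by (auto simp only: imgs)
  qed
qed

end

theory Submission
  imports Defs
begin

text \<open>All the subspaces are real spans of blades \<open>e\<^sub>A\<close> and \<open>\<i> e\<^sub>A\<close>.  With \<open>m\<close> the number of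
  indices common to \<open>A\<close> and \<open>B\<close>, the product \<open>e\<^sub>A e\<^sub>B\<close> is up to sign the blade of the symmetric
  difference, of rank \<open>|A| + |B| - 2m\<close>, and \<open>e\<^sub>A\<close>, \<open>e\<^sub>B\<close> commute iff \<open>|A| |B| - m\<close> is even.  The
  anticommutator of two ranks \<open>k\<close>, \<open>l\<close> therefore only meets the ranks \<open>k + l - 2m\<close> with
  \<open>m \<equiv> k l\<close> modulo 2, and \<open>k + l - m \<le> n\<close> since the union has at most \<open>n\<close> elements; closure is a
  condition on index sets.  Directness holds because the complex coordinates of a vector separate the
  blades, and their real and imaginary parts the two phases.\<close>

subsection \<open>Index sets closed under the anticommutator\<close>

text \<open>A pair \<open>(b, k)\<close> stands for the real space of rank \<open>k\<close>, multiplied by \<open>\<i>\<close> if \<open>b\<close> holds.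
  Below, \<open>k * l + m\<close> replaces \<open>k * l - m\<close> to avoid truncated subtraction.\<close>

definition anticommutator_rank :: "nat \<Rightarrow> nat \<Rightarrow> nat \<Rightarrow> nat \<Rightarrow> bool" where
  "anticommutator_rank n k l r \<longleftrightarrow>
     (\<exists>m. m \<le> k \<and> m \<le> l \<and> k + l - m \<le> n \<and> even (k * l + m) \<and> r = k + l - 2 * m)"

text \<open>The flag of a product is an exclusive or: \<open>\<i>\<close> times \<open>\<i>\<close>
  is -1, and a sign does not change a real span.\<close>

definition anticommutator_closed :: "nat \<Rightarrow> (bool \<times> nat) set \<Rightarrow> bool" where
  "anticommutator_closed n P \<longleftrightarrow>
     (\<forall>b k c l r. (b, k) \<in> P \<longrightarrow> (c, l) \<in> P \<longrightarrow> anticommutator_rank n k l r \<longrightarrow> (b \<noteq> c, r) \<in> P)"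

section \<open>Products among the ranks 0, 1, \<open>n - 1\<close> and \<open>n\<close>\<close>

lemma anticommutator_rank_commute: "anticommutator_rank n k l r \<longleftrightarrow> anticommutator_rank n l k r"
  by (auto simp: anticommutator_rank_def add.commute mult.commute)

lemma anticommutator_rank_0:
  "anticommutator_rank n 0 k r \<Longrightarrow> r = k" "anticommutator_rank n k 0 r \<Longrightarrow> r = k"
  by (auto simp: anticommutator_rank_def)

text \<open>Parity makes \<open>m\<close> congruent to \<open>k\<close> modulo 2. Moreover
  \<open>m\<close> is at least \<open>k - 1\<close>: trivially for \<open>k = 1\<close>, and
  otherwise because the bound on the union forces \<open>m \<ge> 2 * k - n\<close>. Hence
  \<open>m = k\<close>, so only equal index sets contribute.\<close>

lemma anticommutator_rank_self:
  assumes "k \<in> {1, n - 1, n}" "anticommutator_rank n k k r"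
  shows "r = 0"
proof -
  obtain m where m: "m \<le> k" "k + k - m \<le> n" "even (k * k + m)" "r = k + k - 2 * m"
    using assms(2) by (auto simp: anticommutator_rank_def)
  then have "even (k + m)" by simp
  moreover have "k \<le> m + 1" using assms(1) m(1,2) by auto
  ultimately have "m = k" using m(1) by presburger
  with m(4) show ?thesis by simp
qed

text \<open>A blade of top rank contains every index, so \<open>m = k\<close>. Then
  \<open>k * n\<close> is even while \<open>k\<close> is odd, and the two blades
  anticommute.\<close>

lemma anticommutator_rank_even_dim:
  assumes "even n" "n \<noteq> 0" "k \<in> {1, n - 1}"
  shows "\<not> anticommutator_rank n k n r" "\<not> anticommutator_rank n n k r"
proof -
  show "\<not> anticommutator_rank n k n r"
  proof
    assume "anticommutator_rank n k n r"
    then obtain m where m: "m \<le> k" "k + n - m \<le> n" "even (k * n + m)"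
      by (auto simp: anticommutator_rank_def)
    then have "m = k" "even m" using assms(1) by auto
    with assms show False by auto
  qed
  then show "\<not> anticommutator_rank n n k r" by (simp add: anticommutator_rank_commute[of n n k])
qed

text \<open>Against the top rank, \<open>m\<close> equals the other rank. For the ranks 1 and
  \<open>n - 1\<close>, evenness of \<open>n - 1\<close> forces \<open>m\<close> to be even, so
  \<open>m = 0\<close>. For \<open>n \<ge> 3\<close> the ranks 0, 1, \<open>n - 1\<close>,
  \<open>n\<close> thus combine like a Klein four-group.\<close>

lemma anticommutator_rank_odd_dim:
  assumes "odd n"
  shows "anticommutator_rank n 1 (n - 1) r \<Longrightarrow> r = n"
    and "anticommutator_rank n 1 n r \<Longrightarrow> r = n - 1"
    and "anticommutator_rank n (n - 1) n r \<Longrightarrow> r = 1"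
proof -
  show "r = n" if "anticommutator_rank n 1 (n - 1) r"
  proof -
    obtain m where m: "m \<le> 1" "even (1 * (n - 1) + m)" "r = 1 + (n - 1) - 2 * m"
      using \<open>anticommutator_rank n 1 (n - 1) r\<close> unfolding anticommutator_rank_def by blast
    then have "m = 0" using assms by (cases m) auto
    with m assms show "r = n" by (cases n) auto
  qed
  show "r = n - 1" if "anticommutator_rank n 1 n r"
  proof -
    obtain m where m: "m \<le> 1" "1 + n - m \<le> n" "r = 1 + n - 2 * m"
      using \<open>anticommutator_rank n 1 n r\<close> unfolding anticommutator_rank_def by blast
    then show ?thesis by linarith
  qed
  show "r = 1" if "anticommutator_rank n (n - 1) n r"
  proof -
    obtain m where m: "m \<le> n - 1" "n - 1 + n - m \<le> n" "r = n - 1 + n - 2 * m"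
      using \<open>anticommutator_rank n (n - 1) n r\<close> unfolding anticommutator_rank_def by blast
    moreover have "n \<ge> 1" using assms by (cases n) auto
    ultimately show ?thesis by linarith
  qed
qed

lemma anticommutator_closed_0:
  "anticommutator_closed n {(False, 0)}" "anticommutator_closed n (UNIV \<times> {0})"
  by (auto simp: anticommutator_closed_def dest: anticommutator_rank_0)

lemma anticommutator_closed_pair:
  assumes "k \<in> {1, n - 1, n}"
  shows "anticommutator_closed n {(False, 0), (b, k)}" "anticommutator_closed n (UNIV \<times> {0, k})"
  unfolding anticommutator_closed_def
  by (auto dest: anticommutator_rank_0 anticommutator_rank_self[OF assms])

text \<open>No product of the ranks \<open>k\<close> and \<open>n\<close> survives, so their flags
  \<open>b\<close> and \<open>c\<close> can be chosen independently.\<close>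

lemma anticommutator_closed_even_dim:
  assumes "even n" "n \<noteq> 0" "k \<in> {1, n - 1}"
  shows "anticommutator_closed n {(False, 0), (b, k), (c, n)}"
    and "anticommutator_closed n (UNIV \<times> {0, k, n})"
proof -
  have "k \<in> {1, n - 1, n}" "n \<in> {1, n - 1, n}" using assms(3) by auto
  note rules = anticommutator_rank_0 this[THEN anticommutator_rank_self]
    anticommutator_rank_even_dim[OF assms, THEN notE]
  show "anticommutator_closed n {(False, 0), (b, k), (c, n)}"
    and "anticommutator_closed n (UNIV \<times> {0, k, n})"
    unfolding anticommutator_closed_def by (auto dest: rules(1-4) elim: rules(5-))
qed

text \<open>The third nontrivial element of the Klein four-group is the product of the other two,
  hence the flag \<open>b \<noteq> c\<close> at rank \<open>n\<close>.\<close>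

lemma anticommutator_closed_odd_dim:
  assumes "odd n"
  shows "anticommutator_closed n {(False, 0), (b, 1), (c, n - 1), (b \<noteq> c, n)}"
    and "anticommutator_closed n (UNIV \<times> {0, 1, n - 1, n})"
proof -
  have "1 \<in> {1, n - 1, n}" "n - 1 \<in> {1, n - 1, n}" "n \<in> {1, n - 1, n}" by auto
  note rules = anticommutator_rank_0 this[THEN anticommutator_rank_self]
    anticommutator_rank_odd_dim[OF assms]
    anticommutator_rank_odd_dim[OF assms, unfolded anticommutator_rank_commute[of n 1]
      anticommutator_rank_commute[of n "n - 1" n]]
  show "anticommutator_closed n {(False, 0), (b, 1), (c, n - 1), (b \<noteq> c, n)}"
    and "anticommutator_closed n (UNIV \<times> {0, 1, n - 1, n})"
    unfolding anticommutator_closed_def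
    by (auto simp del: One_nat_def dest: rules)
qed

section \<open>Rank sets periodic modulo 4\<close>

definition periodic_ranks :: "nat \<Rightarrow> (bool \<times> nat) set \<Rightarrow> (bool \<times> nat) set" where
  "periodic_ranks n R = {(b, j). j \<le> n \<and> (b, j mod 4) \<in> R}"

lemma periodic_ranks_Un: "periodic_ranks n R \<union> periodic_ranks n R' = periodic_ranks n (R \<union> R')"
  by (auto simp: periodic_ranks_def)

text \<open>\<open>2 * (k * l + m)\<close> is a multiple of 4, so subtracting \<open>2 * m\<close>
  amounts to adding \<open>2 * k * l\<close>, which depends only on the residues.\<close>

lemma shared_rank_mod_4:
  fixes k l m :: nat
  assumes "m \<le> k" "m \<le> l" "even (k * l + m)"
  shows "(k + l - 2 * m) mod 4 = (k mod 4 + l mod 4 + 2 * (k mod 4) * (l mod 4)) mod 4"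
proof -
  obtain r where r: "k * l + m = 2 * r" using assms(3) by (rule evenE)
  have "k + l + 2 * (k * l) = (k + l - 2 * m) + 4 * r" using r assms by linarith
  then have "(k + l - 2 * m) mod 4 = (k + l + 2 * k * l) mod 4"
    by (simp add: mult.assoc)
  also have "\<dots> = (k mod 4 + l mod 4 + 2 * (k mod 4) * (l mod 4)) mod 4"
    by (intro mod_add_cong mod_mult_cong) simp_all
  finally show ?thesis .
qed

text \<open>The residue of the resulting rank is a function of the two given residues, so closure in
  every dimension is one check on \<open>R\<close>. The rank itself is at most
  \<open>k + l - m\<close>, hence at most \<open>n\<close>.\<close>

lemma anticommutator_closed_periodic:
  assumes "\<forall>(b, k)\<in>R. \<forall>(c, l)\<in>R. (b \<noteq> c, (k + l + 2 * k * l) mod 4) \<in> R"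
  shows "anticommutator_closed n (periodic_ranks n R)"
proof -
  have "(b \<noteq> c, r mod 4) \<in> R \<and> r \<le> n"
    if R: "(b, k mod 4) \<in> R" "(c, l mod 4) \<in> R" and r: "anticommutator_rank n k l r" for b c k l r
  proof -
    obtain m where m: "m \<le> k" "m \<le> l" "k + l - m \<le> n" "even (k * l + m)" "r = k + l - 2 * m"
      using r unfolding anticommutator_rank_def by blast
    then have "r \<le> n" by linarith
    then show ?thesis using assms R shared_rank_mod_4[OF m(1,2,4)] m(5) by fastforce
  qed
  then show ?thesis
    unfolding anticommutator_closed_def periodic_ranks_def by auto
qed

subsection \<open>Products of blades\<close>

context complex_clifford_algebra
begin

lemma gen_square:
  assumes "a \<in> {1..p + q}"
  shows "gen a * gen a \<in> {1, -1}"
proof -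
  \<comment> \<open>The relation with equal indices only gives twice the square; the factor 2 is
    cancelled in the complex scalars.\<close>
  have "2 *\<^sub>C (gen a * gen a) = 2 *\<^sub>C (signature p a a *\<^sub>C 1)"
    using gen_anticommute[OF assms assms] scale_left_distrib[of 1 1 "gen a * gen a"] by simp
  then have "gen a * gen a = signature p a a *\<^sub>C 1"
    by (simp only: scale_cancel_left) simp
  then show ?thesis by (simp add: signature_def)
qed

lemma gen_swap:
  assumes "a \<in> {1..p + q}" "b \<in> {1..p + q}" "a \<noteq> b"
  shows "gen a * gen b = - (gen b * gen a)"
  using gen_anticommute[OF assms(1,2)] assms(3)
  by (simp add: signature_def eq_neg_iff_add_eq_0)

text \<open>Letters may come in any order, so that inductions can peel off one generator at a time;
  a blade is the word of its increasing list.\<close>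

definition word :: "nat list \<Rightarrow> 'a" where
  "word xs = prod_list (map gen xs)"

lemma word_simps [simp]: "word [] = 1" "word (x # xs) = gen x * word xs"
  by (simp_all add: word_def)

lemma blade_eq_word: "blade A = word (sorted_list_of_set A)"
  by (simp add: blade_def word_def)

section \<open>Signs from reordering generators\<close>

lemma mult_sign_left_commute: "x * ((-1) ^ k * y) = (-1) ^ k * (x * y)" for x y :: 'a
  by (cases "even k") simp_all

text \<open>The generator passes every letter other than itself at the cost of a sign. Its own
  letter costs none, and adding 1 to the exponent for it has the same parity as subtracting
  1.\<close>

lemma gen_word_commute:
  assumes "a \<in> {1..p + q}" "distinct xs" "set xs \<subseteq> {1..p + q}"
  shows "gen a * word xs = (-1) ^ (length xs + card ({a} \<inter> set xs)) * (word xs * gen a)"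
  using assms(2,3)
proof (induction xs)
  case (Cons x xs)
  let ?k = "length xs + card ({a} \<inter> set xs)"
  have IH: "gen a * word xs = (-1) ^ ?k * (word xs * gen a)" using Cons by simp
  show ?case
  proof (cases "a = x")
    case True
    then have "?k = length xs" using Cons.prems by simp
    with True have "gen a * word (x # xs) = gen x * ((-1) ^ length xs * (word xs * gen a))"
      using IH by simp
    also have "\<dots> = (-1) ^ length xs * (word (x # xs) * gen a)"
      by (simp add: mult_sign_left_commute mult.assoc)
    \<comment> \<open>The exponent in the goal is larger by two: once for the extra letter and once
      for the coincidence.\<close>
    finally show ?thesis using True Cons.prems by simp
  next
    case False
    then have "gen a * word (x # xs) = - (gen x * (gen a * word xs))"
      using gen_swap[of a x] assms(1) Cons.prems by (simp flip: mult.assoc)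
    also have "\<dots> = - (gen x * ((-1) ^ ?k * (word xs * gen a)))"
      unfolding IH ..
    also have "\<dots> = (-1) ^ Suc ?k * (word (x # xs) * gen a)"
      unfolding mult_sign_left_commute by (simp add: mult.assoc)
    finally show ?thesis using False Cons.prems by simp
  qed
qed simp

lemma word_commute:
  assumes "distinct xs" "set xs \<subseteq> {1..p + q}" "distinct ys" "set ys \<subseteq> {1..p + q}"
  shows "word xs * word ys =
    (-1) ^ (length xs * length ys + card (set xs \<inter> set ys)) * (word ys * word xs)"
  using assms(1,2)
proof (induction xs)
  case (Cons x xs)
  let ?k = "length xs * length ys + card (set xs \<inter> set ys)"
    and ?l = "length ys + card ({x} \<inter> set ys)"
  have "set (x # xs) \<inter> set ys = ({x} \<inter> set ys) \<union> (set xs \<inter> set ys)" by auto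
  moreover have "card (({x} \<inter> set ys) \<union> (set xs \<inter> set ys))
      = card ({x} \<inter> set ys) + card (set xs \<inter> set ys)"
    using Cons.prems by (intro card_Un_disjoint) auto
  ultimately have exponent:
    "length (x # xs) * length ys + card (set (x # xs) \<inter> set ys) = ?k + ?l"
    by simp
  have "word (x # xs) * word ys = gen x * (word xs * word ys)" by (simp add: mult.assoc)
  also have "\<dots> = gen x * ((-1) ^ ?k * (word ys * word xs))" using Cons by simp
  also have "\<dots> = (-1) ^ ?k * (gen x * word ys * word xs)"
    unfolding mult_sign_left_commute by (simp only: mult.assoc)
  also have "gen x * word ys = (-1) ^ ?l * (word ys * gen x)"
    using Cons.prems assms by (intro gen_word_commute) auto
  also have "(-1) ^ ?k * ((-1) ^ ?l * (word ys * gen x) * word xs)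
      = (-1) ^ (?k + ?l) * (word ys * word (x # xs))"
    by (simp add: power_add mult.assoc)
  finally show ?case unfolding exponent .
qed simp

text \<open>One step of insertion sort: the generator moves right past smaller letters, changing
  sign each time. It stops before a larger letter or at the end, or it meets itself, and the square
  leaves only a sign.\<close>

lemma gen_times_word:
  assumes "a \<in> {1..p + q}" "sorted ys" "distinct ys" "set ys \<subseteq> {1..p + q}"
  shows "\<exists>zs. sorted zs \<and> distinct zs \<and> set zs = sym_diff {a} (set ys) \<and>
    gen a * word ys \<in> {word zs, - word zs}"
  using assms(2-)
proof (induction ys)
  case Nil
  then show ?case by (intro exI[of _ "[a]"]) simp
next
  case (Cons y ys)
  consider "a < y" | "a = y" | "y < a" by linarith
  then show ?case
  proof cases
    case 1
    with Cons.prems show ?thesis by (intro exI[of _ "a # y # ys"]) auto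
  next
    case 2
    have "gen a * word (y # ys) = gen a * gen a * word ys" using 2 by (simp add: mult.assoc)
    with 2 Cons.prems gen_square[OF assms(1)] show ?thesis
      by (intro exI[of _ ys]) auto
  next
    case 3
    obtain zs where zs: "sorted zs" "distinct zs" "set zs = sym_diff {a} (set ys)"
      "gen a * word ys \<in> {word zs, - word zs}"
      using Cons by auto
    have "gen a * word (y # ys) = - (gen y * (gen a * word ys))"
      using gen_swap[of a y] assms(1) Cons.prems 3 by (simp flip: mult.assoc)
    with zs 3 Cons.prems show ?thesis
      by (intro exI[of _ "y # zs"]) auto
  qed
qed

lemma gen_times_blade:
  assumes "a \<in> {1..p + q}" "B \<subseteq> {1..p + q}"
  shows "gen a * blade B \<in> {blade (sym_diff {a} B), - blade (sym_diff {a} B)}"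
proof -
  have fin: "finite B" using assms(2) finite_subset by blast
  then obtain zs where zs: "sorted zs" "distinct zs" "set zs = sym_diff {a} B"
    "gen a * word (sorted_list_of_set B) \<in> {word zs, - word zs}"
    using gen_times_word[of a "sorted_list_of_set B"] assms by auto
  then have "sorted_list_of_set (sym_diff {a} B) = zs"
    using sorted_list_of_set.idem_if_sorted_distinct[of zs] by simp
  with zs show ?thesis by (simp add: blade_eq_word)
qed

lemma word_times_blade:
  assumes "distinct xs" "set xs \<subseteq> {1..p + q}" "B \<subseteq> {1..p + q}"
  shows "word xs * blade B \<in> {blade (sym_diff (set xs) B), - blade (sym_diff (set xs) B)}"
  using assms(1,2)
proof (induction xs)
  case (Cons x xs)
  let ?C = "sym_diff (set xs) B"
  have "sym_diff (set (x # xs)) B = sym_diff {x} ?C" using Cons.prems by auto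
  moreover have "gen x * blade ?C \<in> {blade (sym_diff {x} ?C), - blade (sym_diff {x} ?C)}"
    using Cons.prems assms(3) by (intro gen_times_blade) auto
  ultimately show ?case using Cons by (auto simp: mult.assoc)
qed simp

lemma blade_times_blade:
  assumes "A \<subseteq> {1..p + q}" "B \<subseteq> {1..p + q}"
  shows "blade A * blade B \<in> {blade (sym_diff A B), - blade (sym_diff A B)}"
  using word_times_blade[of "sorted_list_of_set A" B] assms finite_subset[OF assms(1)]
  by (simp add: blade_eq_word)

lemma blade_commute:
  assumes "A \<subseteq> {1..p + q}" "B \<subseteq> {1..p + q}"
  shows "blade A * blade B = (-1) ^ (card A * card B + card (A \<inter> B)) * (blade B * blade A)"
  using word_commute[of "sorted_list_of_set A" "sorted_list_of_set B"] assms
    finite_subset[OF assms(1)] finite_subset[OF assms(2)]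
  by (simp add: blade_eq_word)

subsection \<open>Real subspaces spanned by blades of given ranks\<close>

definition phase :: "bool \<Rightarrow> complex" where
  "phase b = (if b then \<i> else 1)"

definition graded_basis :: "(bool \<times> nat) set \<Rightarrow> 'a set" where
  "graded_basis P = {phase b *\<^sub>C blade A | b A. A \<subseteq> {1..p + q} \<and> (b, card A) \<in> P}"

definition graded_space :: "(bool \<times> nat) set \<Rightarrow> 'a set" where
  "graded_space P = real.span (graded_basis P)"

lemma graded_spaceI:
  assumes "A \<subseteq> {1..p + q}" "(b, card A) \<in> P"
  shows "phase b *\<^sub>C blade A \<in> graded_space P"
  unfolding graded_space_def graded_basis_def using assms by (intro real.span_base) blast

lemma phase_mult: "phase b * phase c \<in> {phase (b \<noteq> c), - phase (b \<noteq> c)}"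
  by (simp add: phase_def)

lemma rank_space_eq: "rank_space j = graded_space {(False, j)}"
  unfolding rank_space_def graded_space_def graded_basis_def
  by (rule arg_cong[where f = real.span]) (auto simp: phase_def)

lemma real_clifford_eq: "real_clifford = graded_space (periodic_ranks (p + q) ({False} \<times> {0..3}))"
proof -
  have "card A \<le> p + q \<and> card A mod 4 \<le> 3" if "A \<subseteq> {1..p + q}" for A
    using card_mono[OF _ that] by simp
  then show ?thesis
    unfolding real_clifford_def graded_space_def graded_basis_def periodic_ranks_def
    by (intro arg_cong[where f = real.span]) (auto simp: phase_def)
qed

text \<open>Sums of subspaces become unions of index sets, so the sums in the theorem can be
  compared as sets of pairs.\<close>

lemma graded_space_Un: "graded_space P + graded_space Q = graded_space (P \<union> Q)"
proof -
  have "graded_basis (P \<union> Q) = graded_basis P \<union> graded_basis Q"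
    unfolding graded_basis_def by blast
  then show ?thesis
    by (auto simp: graded_space_def real.span_Un set_plus_def)
qed

lemma graded_space_empty: "graded_space {} = {0}"
  by (simp add: graded_space_def graded_basis_def)

lemma sum_list_graded_space:
  "sum_list (map (\<lambda>x. graded_space {x}) ps) = graded_space (set ps)"
  by (induction ps) (simp_all add: graded_space_empty graded_space_Un)

lemma quaternion_type_eq: "quaternion_type k = graded_space (periodic_ranks (p + q) {(False, k)})"
proof -
  have "(\<Sum>j\<in>I. rank_space j) = graded_space ({False} \<times> I)" if "finite I" for I
    using that by (induction I) (simp_all add: graded_space_empty graded_space_Un rank_space_eq)
  then have "quaternion_type k = graded_space ({False} \<times> {j. j \<le> p + q \<and> j mod 4 = k})"
    unfolding quaternion_type_def by simp
  also have "{False} \<times> {j. j \<le> p + q \<and> j mod 4 = k} = periodic_ranks (p + q) {(False, k)}"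
    by (auto simp: periodic_ranks_def)
  finally show ?thesis .
qed

text \<open>Multiplication by \<open>c\<close> carries one generating set to the other up to signs,
  which a real span absorbs; only the phase \<open>d\<close> of the coefficient matters.\<close>

lemma scale_graded_space:
  assumes c: "c \<in> {phase d, - phase d}"
  shows "scale c ` graded_space P = graded_space ((\<lambda>(b, k). (b \<noteq> d, k)) ` P)"
proof -
  interpret hom: module_hom "\<lambda>r x. complex_of_real r *\<^sub>C x" "\<lambda>r x. complex_of_real r *\<^sub>C x" "scale c"
    by unfold_locales (simp_all add: scale_right_distrib mult.commute)
  let ?Q = "(\<lambda>(b, k). (b \<noteq> d, k)) ` P"
  have sign: "c * phase b \<in> {phase (b \<noteq> d), - phase (b \<noteq> d)}" for b
    using c by (auto simp: phase_def)
  have "real.span (scale c ` graded_basis P) = real.span (graded_basis ?Q)"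
  proof (subst real.span_eq, intro conjI subsetI)
    fix x assume "x \<in> scale c ` graded_basis P"
    then obtain b A where A: "A \<subseteq> {1..p + q}" "(b, card A) \<in> P" "x = c *\<^sub>C phase b *\<^sub>C blade A"
      by (auto simp: graded_basis_def)
    have "phase (b \<noteq> d) *\<^sub>C blade A \<in> real.span (graded_basis ?Q)"
      using A by (intro graded_spaceI[unfolded graded_space_def]) (auto intro!: image_eqI)
    then show "x \<in> real.span (graded_basis ?Q)"
      using sign[of b] A real.span_neg by (auto simp: scale_minus_left)
  next
    fix x assume "x \<in> graded_basis ?Q"
    then obtain b A where A: "A \<subseteq> {1..p + q}" "(b, card A) \<in> P" "x = phase (b \<noteq> d) *\<^sub>C blade A"
      by (auto simp: graded_basis_def)
    have "c *\<^sub>C phase b *\<^sub>C blade A \<in> real.span (scale c ` graded_basis P)"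
      using A by (intro real.span_base imageI) (auto simp: graded_basis_def)
    then have "(c * phase b) *\<^sub>C blade A \<in> real.span (scale c ` graded_basis P)" by simp
    moreover have "x = (c * phase b) *\<^sub>C blade A \<or> x = - ((c * phase b) *\<^sub>C blade A)"
      using sign[of b] A by auto
    ultimately show "x \<in> real.span (scale c ` graded_basis P)"
      using real.span_neg by blast
  qed
  then show ?thesis by (simp add: graded_space_def hom.span_image)
qed

section \<open>Complex coordinates and directness\<close>

definition coord :: "'a \<Rightarrow> nat set \<Rightarrow> complex" where
  "coord x A = representation (blade ` Pow {1..p + q}) x (blade A)"

lemma blade_basis: "independent (blade ` Pow {1..p + q})" "span (blade ` Pow {1..p + q}) = UNIV"
  "inj_on blade (Pow {1..p + q})"
  using independent_blades span_blades inj_on_blades by (simp_all add: blade_def [abs_def])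

lemma coord_simps:
  "coord 0 A = 0" "coord (x + y) A = coord x A + coord y A" "coord (c *\<^sub>C x) A = c * coord x A"
  by (simp_all add: coord_def representation_zero representation_add representation_scale blade_basis
      del: One_nat_def)

lemma coord_blade:
  assumes "A \<subseteq> {1..p + q}" "B \<subseteq> {1..p + q}"
  shows "coord (blade A) B = (if B = A then 1 else 0)"
  using assms blade_basis(3)
  by (simp add: coord_def representation_basis blade_basis inj_on_eq_iff[OF blade_basis(3)]
      del: One_nat_def)

lemma coord_eq_0_imp:
  assumes "\<And>A. A \<subseteq> {1..p + q} \<Longrightarrow> coord x A = 0"
  shows "x = 0"
proof -
  \<comment> \<open>\<open>representation\<close> is zero off the basis, so the coordinates at the
    blades determine it everywhere.\<close>
  have "representation (blade ` Pow {1..p + q}) x v = 0" for v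
    using assms representation_ne_zero[of "blade ` Pow {1..p + q}" x v] by (auto simp: coord_def)
  then show ?thesis
    using sum_nonzero_representation_eq[of "blade ` Pow {1..p + q}" x] blade_basis by simp
qed

text \<open>Flag \<open>False\<close> contributes only real multiples of a blade and flag
  \<open>True\<close> only imaginary ones. Both vanishing conditions are real linear, so checking
  the generators suffices.\<close>

lemma coord_graded_space:
  assumes "x \<in> graded_space P" "A \<subseteq> {1..p + q}"
  shows "((False, card A) \<notin> P \<longrightarrow> Re (coord x A) = 0) \<and> ((True, card A) \<notin> P \<longrightarrow> Im (coord x A) = 0)"
  using assms(1) unfolding graded_space_def
proof (induction x rule: real.span_induct)
  case base
  show ?case unfolding real.subspace_def by (simp add: coord_simps)
next
  case (step x)
  then show ?case
    using assms(2) by (auto simp: graded_basis_def coord_simps coord_blade phase_def)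
qed

text \<open>For each \<open>A\<close> and each flag \<open>b\<close>, the pair
  \<open>(b, card A)\<close> is missing from \<open>P\<close> or from \<open>Q\<close>, which kills
  the corresponding part of the coordinate.\<close>

lemma graded_space_disjoint:
  assumes "x \<in> graded_space P" "x \<in> graded_space Q" "P \<inter> Q = {}"
  shows "x = 0"
proof (rule coord_eq_0_imp)
  fix A assume "A \<subseteq> {1..p + q}"
  then show "coord x A = 0"
    using assms coord_graded_space[of x P A] coord_graded_space[of x Q A]
    by (auto simp: complex_eq_iff)
qed

lemma direct_sum_graded_space:
  assumes "distinct ps"
  shows "direct_sum (map (\<lambda>x. graded_space {x}) ps)"
  using assms
proof (induction ps)
  case Nil
  then show ?case by (simp add: direct_sum_def)
next
  case (Cons a ps)
  let ?G = "map (\<lambda>x. graded_space {x})"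
  have mem: "sum_list us \<in> graded_space (set ps)" if "list_all2 (\<in>) us (?G ps)" for us ps
    using that
  proof (induction ps arbitrary: us)
    case Nil
    then show ?case by (simp add: graded_space_empty)
  next
    case (Cons a ps)
    then obtain u vs where us: "us = u # vs" "u \<in> graded_space {a}" "list_all2 (\<in>) vs (?G ps)"
      by (auto simp: list_all2_Cons2)
    then have "u + sum_list vs \<in> graded_space {a} + graded_space (set ps)"
      using Cons.IH by (intro set_plus_intro)
    with us show ?case by (simp add: graded_space_Un)
  qed
  show ?case unfolding direct_sum_def
  proof (intro allI impI)
    fix us assume "list_all2 (\<in>) us (?G (a # ps))" and 0: "sum_list us = 0"
    then obtain u vs where us: "us = u # vs" "u \<in> graded_space {a}" "list_all2 (\<in>) vs (?G ps)"
      by (auto simp: list_all2_Cons2)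
    \<comment> \<open>The head lies in its own space and, as minus the sum of the others, in the
      space of the remaining pairs; distinctness makes these two index sets disjoint.\<close>
    have "u = - sum_list vs" using 0 us by (simp add: eq_neg_iff_add_eq_0)
    then have "u \<in> graded_space (set ps)"
      using mem[OF us(3)] real.span_neg by (simp add: graded_space_def)
    then have "u = 0" using us(2) Cons.prems graded_space_disjoint[of u "{a}" "set ps"] by simp
    then show "\<forall>u\<in>set us. u = 0" using 0 us Cons by (auto simp: direct_sum_def)
  qed
qed

section \<open>Closure of graded spaces under the anticommutator\<close>

lemma anticommutator_blades:
  assumes P: "anticommutator_closed (p + q) P"
    and A: "A \<subseteq> {1..p + q}" "(b, card A) \<in> P" and B: "B \<subseteq> {1..p + q}" "(c, card B) \<in> P"
  shows "anticommutator (phase b *\<^sub>C blade A) (phase c *\<^sub>C blade B) \<in> graded_space P"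
proof -
  let ?m = "card (A \<inter> B)"
  have fin: "finite A" "finite B" using A B finite_subset by blast+
  have eq: "anticommutator (phase b *\<^sub>C blade A) (phase c *\<^sub>C blade B)
      = (phase b * phase c) *\<^sub>C (blade A * blade B + blade B * blade A)"
    by (simp add: anticommutator_def scale_mult_left scale_mult_right scale_right_distrib mult.commute)
  show ?thesis
  proof (cases "even (card A * card B + ?m)")
    case False
    then have "blade A * blade B + blade B * blade A = 0"
      using blade_commute[OF A(1) B(1)] by simp
    then show ?thesis unfolding eq by (simp add: graded_space_def real.span_zero)
  next
    case True
    have card_Un: "card (A \<union> B) = card A + card B - ?m"
      using card_Un_Int[OF fin] by simp
    have le: "?m \<le> card A" "?m \<le> card B" using fin by (auto intro: card_mono)
    have "sym_diff A B = (A \<union> B) - (A \<inter> B)" by blast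
    then have "card (sym_diff A B) = card (A \<union> B) - ?m"
      using fin by (simp add: card_Diff_subset le_supI1)
    then have card: "card (sym_diff A B) = card A + card B - 2 * ?m"
      using card_Un by simp
    have "card (A \<union> B) \<le> p + q" using card_mono[of "{1..p + q}" "A \<union> B"] A B by simp
    \<comment> \<open>The witness is the number of shared indices; its upper bound condition is the
      size of the union.\<close>
    then have "anticommutator_rank (p + q) (card A) (card B) (card (sym_diff A B))"
      unfolding anticommutator_rank_def card card_Un using le True by blast
    then have "(b \<noteq> c, card (sym_diff A B)) \<in> P"
      using P A B unfolding anticommutator_closed_def by blast
    then have mem: "phase (b \<noteq> c) *\<^sub>C blade (sym_diff A B) \<in> graded_space P" (is "?y \<in> _")
      using A B by (intro graded_spaceI) auto
    \<comment> \<open>In the even case the blades commute, so the anticommutator is twice a product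
      that equals \<open>?y\<close> up to sign.\<close>
    have "blade A * blade B + blade B * blade A = blade A * blade B + blade A * blade B"
      using True blade_commute[OF A(1) B(1)] by simp
    moreover have "(phase b * phase c) *\<^sub>C (blade A * blade B) \<in> {?y, - ?y}"
      using phase_mult[of b c] blade_times_blade[OF A(1) B(1)] by auto
    then have "(phase b * phase c) *\<^sub>C (blade A * blade B) \<in> graded_space P"
      using mem real.span_neg by (auto simp: graded_space_def)
    ultimately show ?thesis
      unfolding eq by (simp add: scale_right_distrib graded_space_def real.span_add)
  qed
qed

text \<open>Real bilinearity reduces the claim to pairs of generators, by one span induction in each
  argument.\<close>

lemma anticommutator_subalgebra_graded_space:
  assumes P: "anticommutator_closed (p + q) P"
  shows "anticommutator_subalgebra (graded_space P)"
proof -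
  have zero: "0 \<in> graded_space P"
    and add: "x \<in> graded_space P \<Longrightarrow> y \<in> graded_space P \<Longrightarrow> x + y \<in> graded_space P"
    and mult: "x \<in> graded_space P \<Longrightarrow> complex_of_real r *\<^sub>C x \<in> graded_space P" for x y r
    by (simp_all add: graded_space_def real.span_zero real.span_add real.span_scale)
  have linear_left: "real.subspace {x. anticommutator x y \<in> graded_space P}"
    and linear_right: "real.subspace {x. anticommutator y x \<in> graded_space P}" for y
  proof -
    have "anticommutator (x + z) y = anticommutator x y + anticommutator z y"
      "anticommutator y (x + z) = anticommutator y x + anticommutator y z"
      "anticommutator (complex_of_real r *\<^sub>C x) y = complex_of_real r *\<^sub>C anticommutator x y"
      "anticommutator y (complex_of_real r *\<^sub>C x) = complex_of_real r *\<^sub>C anticommutator y x"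
      "anticommutator 0 y = 0" "anticommutator y 0 = 0" for x z r
      by (simp_all add: anticommutator_def algebra_simps scale_mult_left scale_mult_right)
    then show "real.subspace {x. anticommutator x y \<in> graded_space P}"
      "real.subspace {x. anticommutator y x \<in> graded_space P}"
      unfolding real.subspace_def using zero add mult by simp_all
  qed
  have "anticommutator x y \<in> graded_space P"
    if x: "x \<in> graded_space P" and y: "y \<in> graded_space P" for x y
    using x[unfolded graded_space_def]
  proof (induction x rule: real.span_induct)
    case base
    show ?case using linear_left .
  next
    case (step x)
    show ?case using y[unfolded graded_space_def]
    proof (induction y rule: real.span_induct)
      case base
      show ?case using linear_right .
    next
      case (step y)
      with \<open>x \<in> graded_basis P\<close> show ?case
        using anticommutator_blades[OF P] by (auto simp: graded_basis_def)
    qed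
  qed
  then show ?thesis
    unfolding anticommutator_subalgebra_def by (simp add: graded_space_def)
qed

text \<open>Separates combinatorics, the closure of \<open>P\<close>, from bookkeeping:
  \<open>ps\<close> lists the pairs of \<open>P\<close> once each, in the order of the
  summands.\<close>

lemma subalgebraI:
  assumes "anticommutator_closed (p + q) P" "set ps = P" "distinct ps"
    and "Ws = map (\<lambda>x. graded_space {x}) ps"
  shows "direct_sum Ws \<and> anticommutator_subalgebra (sum_list Ws)"
  using assms direct_sum_graded_space anticommutator_subalgebra_graded_space
  by (auto simp: sum_list_graded_space)

lemma scale_ii_graded_space:
  "scale \<i> ` graded_space P = graded_space ((\<lambda>(b, k). (\<not> b, k)) ` P)"
  using scale_graded_space[of \<i> True P] by (simp add: phase_def)

text \<open>The coefficient -1 does occur in the twisted families: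
  \<open>\<i> * rank_coeff 0\<close> is -1.\<close>

lemma scale_unit_graded_space:
  "scale 1 ` graded_space P = graded_space P" "uminus ` graded_space P = graded_space P"
  using scale_graded_space[of 1 False P] scale_graded_space[of "-1" False P]
  by (simp_all add: phase_def)

text \<open>The closure condition says that the pairs \<open>(b, k)\<close> form a subgroup:
  \<open>k + l + 2 * k * l\<close> modulo 4 is the bitwise exclusive or.\<close>

lemma periodic_subalgebra:
  assumes js: "distinct js" "set js = {j. j \<le> p + q \<and> j mod 4 \<in> S}"
    and f: "\<And>j. j \<in> set js \<Longrightarrow> f j \<in> {phase (j mod 4 \<in> I), - phase (j mod 4 \<in> I)}"
    and S: "\<forall>k\<in>S. \<forall>l\<in>S. (k + l + 2 * k * l) mod 4 \<in> S \<and>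
      ((k + l + 2 * k * l) mod 4 \<in> I \<longleftrightarrow> (k \<in> I) \<noteq> (l \<in> I))"
    and Ws: "Ws = map (\<lambda>j. scale (f j) ` rank_space j) js"
  shows "direct_sum Ws \<and> anticommutator_subalgebra (sum_list Ws)"
    and "sum_list Ws = graded_space (periodic_ranks (p + q) ((\<lambda>k. (k \<in> I, k)) ` S))"
proof -
  let ?ps = "map (\<lambda>j. (j mod 4 \<in> I, j)) js" and ?R = "(\<lambda>k. (k \<in> I, k)) ` S"
  have Ws': "Ws = map (\<lambda>x. graded_space {x}) ?ps"
    unfolding Ws using scale_graded_space[OF f] by (simp add: rank_space_eq)
  have set: "set ?ps = periodic_ranks (p + q) ?R"
    using js(2) by (auto simp: periodic_ranks_def image_iff)
  have "distinct ?ps" using js(1) by (simp add: distinct_map inj_on_def)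
  moreover have "anticommutator_closed (p + q) (periodic_ranks (p + q) ?R)"
    using S by (intro anticommutator_closed_periodic) auto
  ultimately show "direct_sum Ws \<and> anticommutator_subalgebra (sum_list Ws)"
    using set Ws' by (intro subalgebraI)
  show "sum_list Ws = graded_space (periodic_ranks (p + q) ?R)"
    unfolding Ws' sum_list_graded_space set ..
qed

lemma periodic_real_subalgebra:
  assumes js: "distinct js" "set js = {j. j \<le> p + q \<and> j mod 4 \<in> S}"
    and S: "\<forall>k\<in>S. \<forall>l\<in>S. (k + l + 2 * k * l) mod 4 \<in> S"
    and Ws: "Ws = map rank_space js"
  shows "direct_sum Ws \<and> anticommutator_subalgebra (sum_list Ws)"
    and "sum_list Ws = graded_space (periodic_ranks (p + q) ({False} \<times> S))"
proof -
  have "{False} \<times> S = Pair False ` S" by auto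
  \<comment> \<open>No rank carries \<open>\<i>\<close> here: \<open>I\<close> is empty and the
    coefficient is constantly 1.\<close>
  then show "direct_sum Ws \<and> anticommutator_subalgebra (sum_list Ws)"
    "sum_list Ws = graded_space (periodic_ranks (p + q) ({False} \<times> S))"
    using periodic_subalgebra[OF js, of "\<lambda>_. 1" "{}" Ws] S Ws
    by (simp_all add: phase_def rank_space_eq scale_unit_graded_space)
qed

text \<open>With both phases present at every rank, closure only concerns the residues.\<close>

lemma periodic_complex_subalgebra:
  assumes js: "distinct js" "set js = {j. j \<le> p + q \<and> j mod 4 \<in> S}"
    and S: "\<forall>k\<in>S. \<forall>l\<in>S. (k + l + 2 * k * l) mod 4 \<in> S"
    and Ws: "Ws = map rank_space js @ map (\<lambda>j. scale \<i> ` rank_space j) js"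
  shows "direct_sum Ws \<and> anticommutator_subalgebra (sum_list Ws)"
    and "sum_list Ws = graded_space (periodic_ranks (p + q) (UNIV \<times> S))"
proof -
  let ?ps = "map (Pair False) js @ map (Pair True) js"
  have Ws': "Ws = map (\<lambda>x. graded_space {x}) ?ps"
    unfolding Ws by (simp add: rank_space_eq scale_ii_graded_space)
  have set: "set ?ps = periodic_ranks (p + q) (UNIV \<times> S)"
    using js(2) by (auto simp: periodic_ranks_def image_iff)
  have "distinct ?ps" using js(1) by (auto simp: distinct_map inj_on_def)
  moreover have "anticommutator_closed (p + q) (periodic_ranks (p + q) (UNIV \<times> S))"
    using S by (intro anticommutator_closed_periodic) auto
  ultimately show "direct_sum Ws \<and> anticommutator_subalgebra (sum_list Ws)"
    using set Ws' by (intro subalgebraI)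
  show "sum_list Ws = graded_space (periodic_ranks (p + q) (UNIV \<times> S))"
    unfolding Ws' sum_list_graded_space set ..
qed

section \<open>Items built from the ranks 0, 1, \<open>n - 1\<close> and \<open>n\<close>\<close>

lemma one_rank_lists:
  "\<forall>Ws\<in>set [[rank_space 0], [rank_space 0, scale \<i> ` rank_space 0]].
     direct_sum Ws \<and> anticommutator_subalgebra (sum_list Ws)"
proof -
  have "direct_sum Ws \<and> anticommutator_subalgebra (sum_list Ws)"
    if "Ws = [rank_space 0]" for Ws
    by (rule subalgebraI[OF anticommutator_closed_0(1), of "[(False, 0)]"])
      (simp_all add: that rank_space_eq)
  moreover have "direct_sum Ws \<and> anticommutator_subalgebra (sum_list Ws)"
    if "Ws = [rank_space 0, scale \<i> ` rank_space 0]" for Ws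
    by (rule subalgebraI[OF anticommutator_closed_0(2), of "[(False, 0), (True, 0)]"])
      (auto simp: that rank_space_eq scale_ii_graded_space)
  ultimately show ?thesis by auto
qed

lemma two_rank_lists:
  assumes "k \<in> {1, p + q - 1, p + q}" "k \<noteq> 0"
  shows "\<forall>Ws\<in>set [[rank_space 0, rank_space k], [rank_space 0, scale \<i> ` rank_space k],
      [rank_space 0, rank_space k, scale \<i> ` rank_space 0, scale \<i> ` rank_space k]].
     direct_sum Ws \<and> anticommutator_subalgebra (sum_list Ws)"
proof -
  \<comment> \<open>With the flag \<open>b\<close> left open, one argument covers both the real and
    the imaginary version of the second summand.\<close>
  have "direct_sum Ws \<and> anticommutator_subalgebra (sum_list Ws)"
    if "Ws = [rank_space 0, graded_space {(b, k)}]" for Ws b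
    using assms(2)
    by (intro subalgebraI[OF anticommutator_closed_pair(1)[OF assms(1)], of "[(False, 0), (b, k)]"])
      (simp_all add: that rank_space_eq)
  moreover have "direct_sum Ws \<and> anticommutator_subalgebra (sum_list Ws)"
    if "Ws = [rank_space 0, rank_space k, scale \<i> ` rank_space 0, scale \<i> ` rank_space k]" for Ws
    using assms(2)
    by (intro subalgebraI[OF anticommutator_closed_pair(2)[OF assms(1)],
          of "[(False, 0), (False, k), (True, 0), (True, k)]"])
      (auto simp: that rank_space_eq scale_ii_graded_space)
  ultimately show ?thesis by (simp add: rank_space_eq scale_ii_graded_space)
qed

lemma three_rank_lists:
  assumes "even (p + q)" "p + q \<noteq> 0" "k \<in> {1, p + q - 1}" "k \<noteq> 0" "k \<noteq> p + q"
  shows "\<forall>Ws\<in>set [[rank_space 0, rank_space k, rank_space (p + q)],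
      [rank_space 0, scale \<i> ` rank_space k, scale \<i> ` rank_space (p + q)],
      [rank_space 0, scale \<i> ` rank_space k, rank_space (p + q)],
      [rank_space 0, rank_space k, scale \<i> ` rank_space (p + q)],
      [rank_space 0, rank_space k, rank_space (p + q),
       scale \<i> ` rank_space 0, scale \<i> ` rank_space k, scale \<i> ` rank_space (p + q)]].
     direct_sum Ws \<and> anticommutator_subalgebra (sum_list Ws)"
proof -
  note closed = anticommutator_closed_even_dim[OF assms(1-3)]
  have "direct_sum Ws \<and> anticommutator_subalgebra (sum_list Ws)"
    if "Ws = [rank_space 0, graded_space {(b, k)}, graded_space {(c, p + q)}]" for Ws b c
    using assms(2,4,5)
    by (intro subalgebraI[OF closed(1), of "[(False, 0), (b, k), (c, p + q)]"])
      (simp_all add: that rank_space_eq)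
  moreover have "direct_sum Ws \<and> anticommutator_subalgebra (sum_list Ws)"
    if "Ws = [rank_space 0, rank_space k, rank_space (p + q),
       scale \<i> ` rank_space 0, scale \<i> ` rank_space k, scale \<i> ` rank_space (p + q)]" for Ws
    using assms(2,4,5)
    by (intro subalgebraI[OF closed(2), of "[(False, 0), (False, k), (False, p + q),
          (True, 0), (True, k), (True, p + q)]"])
      (auto simp: that rank_space_eq scale_ii_graded_space)
  ultimately show ?thesis by (simp add: rank_space_eq scale_ii_graded_space)
qed

lemma four_rank_lists:
  assumes "odd (p + q)" "p + q \<ge> 3"
  shows "\<forall>Ws\<in>set [[rank_space 0, rank_space 1, rank_space (p + q - 1), rank_space (p + q)],
      [rank_space 0, rank_space 1, scale \<i> ` rank_space (p + q - 1), scale \<i> ` rank_space (p + q)],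
      [rank_space 0, scale \<i> ` rank_space 1, scale \<i> ` rank_space (p + q - 1), rank_space (p + q)],
      [rank_space 0, scale \<i> ` rank_space 1, rank_space (p + q - 1), scale \<i> ` rank_space (p + q)],
      [rank_space 0, rank_space 1, rank_space (p + q - 1), rank_space (p + q),
       scale \<i> ` rank_space 0, scale \<i> ` rank_space 1,
       scale \<i> ` rank_space (p + q - 1), scale \<i> ` rank_space (p + q)]].
     direct_sum Ws \<and> anticommutator_subalgebra (sum_list Ws)"
proof -
  note closed = anticommutator_closed_odd_dim[OF assms(1)]
  \<comment> \<open>From \<open>p + q \<ge> 3\<close> the four ranks are distinct, so the list of
    pairs has no repetition.\<close>
  have four: "direct_sum Ws \<and> anticommutator_subalgebra (sum_list Ws)"
    if "Ws = [rank_space 0, graded_space {(b, 1)}, graded_space {(c, p + q - 1)},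
      graded_space {(b \<noteq> c, p + q)}]" for Ws b c
    using assms(2)
    by (intro subalgebraI[OF closed(1), of "[(False, 0), (b, 1), (c, p + q - 1), (b \<noteq> c, p + q)]"])
      (auto simp add: that rank_space_eq)
  have full: "direct_sum Ws \<and> anticommutator_subalgebra (sum_list Ws)"
    if "Ws = [rank_space 0, rank_space 1, rank_space (p + q - 1), rank_space (p + q),
       scale \<i> ` rank_space 0, scale \<i> ` rank_space 1,
       scale \<i> ` rank_space (p + q - 1), scale \<i> ` rank_space (p + q)]" for Ws
    using assms(2)
    by (intro subalgebraI[OF closed(2), of "[(False, 0), (False, 1), (False, p + q - 1),
          (False, p + q), (True, 0), (True, 1), (True, p + q - 1), (True, p + q)]"])
      (auto simp: that rank_space_eq scale_ii_graded_space)
  \<comment> \<open>The four choices of flags at the ranks 1 and \<open>n - 1\<close> determine the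
    flag at the top rank and give the first four lists.\<close>
  show ?thesis
    using full four[of _ False False] four[of _ False True] four[of _ True True] four[of _ True False]
    by (simp add: rank_space_eq scale_ii_graded_space)
qed

text \<open>The sets \<open>{2, 3}\<close>, \<open>{1, 2}\<close> and \<open>{1, 3}\<close> of
  residues with imaginary coefficient are the supports of the three nontrivial homomorphisms from
  the residues under exclusive or to the flags. Signs are left open because a real span absorbs
  them.\<close>

lemma rank_coeff_phase:
  "\<i> * rank_coeff (int j) \<in> {phase (j mod 4 \<in> {2, 3}), - phase (j mod 4 \<in> {2, 3})}"
  "rank_coeff (int j - 1) \<in> {phase (j mod 4 \<in> {1, 2}), - phase (j mod 4 \<in> {1, 2})}"
  "\<i> ^ j * (-1) ^ (j * (j - 1) div 2) \<in> {phase (j mod 4 \<in> {1, 3}), - phase (j mod 4 \<in> {1, 3})}"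
proof -
  \<comment> \<open>For \<open>j = 0\<close> the shifted argument is -1, whose residue 3 gives
    coefficient 1, so rank 0 stays real.\<close>
  have "int j mod 4 \<in> {2, 3} \<longleftrightarrow> j mod 4 \<in> {2, 3}"
    "(int j - 1) mod 4 \<in> {2, 3} \<longleftrightarrow> j mod 4 \<notin> {1, 2}"
    by (simp; presburger)+
  then show "\<i> * rank_coeff (int j) \<in> {phase (j mod 4 \<in> {2, 3}), - phase (j mod 4 \<in> {2, 3})}"
    "rank_coeff (int j - 1) \<in> {phase (j mod 4 \<in> {1, 2}), - phase (j mod 4 \<in> {1, 2})}"
    unfolding rank_coeff_def phase_def by (simp_all only:) auto
  have "\<i> ^ j \<in> {phase (odd j), - phase (odd j)}"
    by (cases "even j") (auto elim!: evenE oddE simp: phase_def power_mult minus_one_power_iff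
      split: if_splits)
  moreover have "j mod 4 \<in> {1, 3} \<longleftrightarrow> odd j" by (simp; presburger)
  moreover have "(-1) ^ k \<in> {1, - 1 :: complex}" for k by (cases "even k") auto
  ultimately show "\<i> ^ j * (-1) ^ (j * (j - 1) div 2)
      \<in> {phase (j mod 4 \<in> {1, 3}), - phase (j mod 4 \<in> {1, 3})}"
    by (smt (verit, best) insert_iff minus_minus mult.right_neutral mult_minus_right singletonD)
qed

text \<open>Serves the families with residues \<open>{0, 2}\<close>, \<open>{0, 3}\<close> and
  \<open>{0, 1}\<close>: the real, the twisted and the complex variant share one list of ranks, and
  their sums come out in the form to which quaternion types are also reduced.\<close>

lemma periodic_lists:
  assumes js: "distinct js" "set js = {j. j \<le> p + q \<and> j mod 4 \<in> S}"
    and f: "\<And>j. f j \<in> {phase (j mod 4 \<in> I), - phase (j mod 4 \<in> I)}"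
    and S: "\<forall>k\<in>S. \<forall>l\<in>S. (k + l + 2 * k * l) mod 4 \<in> S \<and>
      ((k + l + 2 * k * l) mod 4 \<in> I \<longleftrightarrow> (k \<in> I) \<noteq> (l \<in> I))"
    and L: "L = [map rank_space js, map (\<lambda>j. scale (f j) ` rank_space j) js,
      map rank_space js @ map (\<lambda>j. scale \<i> ` rank_space j) js]"
  shows "\<forall>Ws\<in>set L. direct_sum Ws \<and> anticommutator_subalgebra (sum_list Ws)"
    and "map sum_list L = [graded_space (periodic_ranks (p + q) ({False} \<times> S)),
      graded_space (periodic_ranks (p + q) ((\<lambda>k. (k \<in> I, k)) ` S)),
      graded_space (periodic_ranks (p + q) (UNIV \<times> S))]"
proof -
  have S': "\<forall>k\<in>S. \<forall>l\<in>S. (k + l + 2 * k * l) mod 4 \<in> S" using S by blast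
  note parts = periodic_real_subalgebra[OF js S' refl]
    periodic_subalgebra[OF js f S refl] periodic_complex_subalgebra[OF js S' refl]
  show "\<forall>Ws\<in>set L. direct_sum Ws \<and> anticommutator_subalgebra (sum_list Ws)"
    unfolding L using parts by (simp only: list.set ball_simps)
  show "map sum_list L = [graded_space (periodic_ranks (p + q) ({False} \<times> S)),
      graded_space (periodic_ranks (p + q) ((\<lambda>k. (k \<in> I, k)) ` S)),
      graded_space (periodic_ranks (p + q) (UNIV \<times> S))]"
    unfolding L using parts by (simp only: list.map)
qed

lemma scale_ii_periodic:
  "scale \<i> ` graded_space (periodic_ranks n R) =
    graded_space (periodic_ranks n ((\<lambda>(b, k). (\<not> b, k)) ` R))"
proof -
  have "(\<lambda>(b, k). (\<not> b, k)) ` periodic_ranks n R = periodic_ranks n ((\<lambda>(b, k). (\<not> b, k)) ` R)"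
    by (force simp: periodic_ranks_def image_iff)
  then show ?thesis by (simp add: scale_ii_graded_space)
qed

text \<open>Normalises sums of quaternion types, with or without a factor \<open>\<i>\<close>, to
  one graded space, so that identities between them become equalities of sets of residues with
  flags.\<close>

lemmas quaternion_simps = quaternion_type_eq graded_space_Un periodic_ranks_Un scale_ii_periodic

end

subsection \<open>The subalgebras\<close>

text \<open>\<open>same\<close> and \<open>among\<close> compare the resulting subspaces rather than
  the lists of summands. Inclusion is used in those low dimensions where the periodic family has
  fewer variants than the item it reduces to.\<close>

theorem theorem12:
  fixes scale :: "complex \<Rightarrow> 'a::ring_1 \<Rightarrow> 'a" and gen :: "nat \<Rightarrow> 'a" and p q n :: nat
  assumes "complex_clifford_algebra scale gen p q" and "n = p + q" and "n \<ge> 1"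
  shows
    "let
       H = complex_clifford_algebra.rank_space scale gen p q;
       T = complex_clifford_algebra.quaternion_type scale gen p q;
       Cl = complex_clifford_algebra.real_clifford scale gen p q;
       J = (\<lambda>W. scale \<i> ` W);
       subalg = (\<lambda>Ws. direct_sum Ws \<and>
            complex_clifford_algebra.anticommutator_subalgebra scale (sum_list Ws));
       same = (\<lambda>L L'. sum_list ` set L = sum_list ` set L');
       among = (\<lambda>L L'. sum_list ` set L \<subseteq> sum_list ` set L');
       L1 = [[H 0], [H 0, J (H 0)]];
       L2 = [[H 0, H 1], [H 0, J (H 1)], [H 0, H 1, J (H 0), J (H 1)]];
       L3 = [[H 0, H n], [H 0, J (H n)], [H 0, H n, J (H 0), J (H n)]];
       L4 = [[H 0, H (n - 1)], [H 0, J (H (n - 1))],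
                [H 0, H (n - 1), J (H 0), J (H (n - 1))]];
       L5 = [[H 0, H 1, H n], [H 0, J (H 1), J (H n)], [H 0, J (H 1), H n],
                [H 0, H 1, J (H n)], [H 0, H 1, H n, J (H 0), J (H 1), J (H n)]];
       L6 = [[H 0, H (n - 1), H n], [H 0, J (H (n - 1)), J (H n)],
                [H 0, J (H (n - 1)), H n], [H 0, H (n - 1), J (H n)],
                [H 0, H (n - 1), H n, J (H 0), J (H (n - 1)), J (H n)]];
       L7 = (\<lambda>k. let js = filter even [0..<k + 1] in
                [map H js,
                 map (\<lambda>j. scale (\<i> * rank_coeff (int j)) ` H j) js,
                 map H js @ map (\<lambda>j. J (H j)) js]);
       L8 = [[H 0, H 1, H (n - 1), H n], [H 0, H 1, J (H (n - 1)), J (H n)],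
                [H 0, J (H 1), J (H (n - 1)), H n], [H 0, J (H 1), H (n - 1), J (H n)],
                [H 0, H 1, H (n - 1), H n, J (H 0), J (H 1), J (H (n - 1)), J (H n)]];
       L9 = (\<lambda>k. let js = filter (\<lambda>j. j mod 4 \<in> {0, 3}) [0..<k + 1] in
                [map H js,
                 map (\<lambda>j. scale (\<i> * rank_coeff (int j)) ` H j) js,
                 map H js @ map (\<lambda>j. J (H j)) js]);
       L10 = (\<lambda>k. let js = filter (\<lambda>j. j mod 4 \<in> {0, 1}) [0..<k + 1] in
                [map H js,
                 map (\<lambda>j. scale (rank_coeff (int j - 1)) ` H j) js,
                 map H js @ map (\<lambda>j. J (H j)) js]);
       L11 = (\<lambda>k. let js = filter (\<lambda>j. j mod 4 = 0) [0..<k + 1] in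
                [map H js,
                 map H js @ map (\<lambda>j. J (H j)) js]);
       L12 = (let js = [0..<n + 1] in
                [map H js,
                 map (\<lambda>j. scale (\<i> * rank_coeff (int j)) ` H j) js,
                 map (\<lambda>j. scale (\<i> ^ j * (-1) ^ (j * (j - 1) div 2)) ` H j) js,
                 map (\<lambda>j. scale (rank_coeff (int j - 1)) ` H j) js])
     in
     (\<forall>Ws\<in>set L1. subalg Ws) \<and>
     (n \<ge> 2 \<longrightarrow> (\<forall>Ws\<in>set L2. subalg Ws)) \<and>
     (n \<ge> 2 \<longrightarrow> (\<forall>Ws\<in>set L3. subalg Ws)) \<and>
     (n \<ge> 3 \<longrightarrow> (\<forall>Ws\<in>set L4. subalg Ws)) \<and>
     (even n \<and> n \<ge> 4 \<longrightarrow> (\<forall>Ws\<in>set L5. subalg Ws)) \<and>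
     (even n \<and> n \<ge> 4 \<longrightarrow> (\<forall>Ws\<in>set L6. subalg Ws)) \<and>
     (\<forall>k. even k \<and> n \<in> {k, k + 1} \<longrightarrow>
        (n \<ge> 4 \<longrightarrow> (\<forall>Ws\<in>set (L7 k). subalg Ws) \<and>
           map sum_list (L7 k) = [T 0 + T 2, T 0 + J (T 2), (T 0 + T 2) + J (T 0 + T 2)]) \<and>
        (n = 1 \<longrightarrow> same (L7 k) L1) \<and>
        (n = 2 \<longrightarrow> same (L7 k) L3) \<and>
        (n = 3 \<longrightarrow> same (L7 k) L4)) \<and>
     (odd n \<and> n \<ge> 5 \<longrightarrow> (\<forall>Ws\<in>set L8. subalg Ws)) \<and>
     (\<forall>k. k mod 4 \<in> {0, 3} \<and> (even k \<longrightarrow> n \<in> {k, k + 1, k + 2}) \<and> (odd k \<longrightarrow> n = k) \<longrightarrow>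
        (n \<ge> 5 \<longrightarrow> (\<forall>Ws\<in>set (L9 k). subalg Ws) \<and>
           map sum_list (L9 k) = [T 0 + T 3, T 0 + J (T 3), (T 0 + T 3) + J (T 0 + T 3)]) \<and>
        (n \<in> {1, 2} \<longrightarrow> same (L9 k) L1) \<and>
        (n = 3 \<longrightarrow> same (L9 k) L3) \<and>
        (n = 4 \<longrightarrow> among (L9 k) L6)) \<and>
     (\<forall>k. k mod 4 \<in> {0, 1} \<and> (odd k \<longrightarrow> n \<in> {k, k + 1, k + 2}) \<and> (even k \<longrightarrow> n = k) \<longrightarrow>
        (n \<ge> 6 \<longrightarrow> (\<forall>Ws\<in>set (L10 k). subalg Ws) \<and>
           map sum_list (L10 k) = [T 0 + T 1, T 0 + J (T 1), (T 0 + T 1) + J (T 0 + T 1)]) \<and>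
        (n \<in> {2, 3} \<longrightarrow> same (L10 k) L2) \<and>
        (n = 4 \<longrightarrow> among (L10 k) L5) \<and>
        (n = 5 \<longrightarrow> among (L10 k) L8)) \<and>
     (\<forall>k. k mod 4 = 0 \<and> n \<in> {k, k + 1, k + 2, k + 3} \<longrightarrow>
        (n \<ge> 6 \<longrightarrow> (\<forall>Ws\<in>set (L11 k). subalg Ws) \<and>
           map sum_list (L11 k) = [T 0, T 0 + J (T 0)]) \<and>
        (n \<in> {1, 2, 3} \<longrightarrow> same (L11 k) L1) \<and>
        (n = 4 \<longrightarrow> among (L11 k) L3) \<and>
        (n = 5 \<longrightarrow> among (L11 k) L4)) \<and>
     (n \<ge> 2 \<longrightarrow> (\<forall>Ws\<in>set L12. subalg Ws) \<and>
        map sum_list L12 =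
          [Cl, (T 0 + T 1) + J (T 2 + T 3), (T 0 + T 2) + J (T 1 + T 3),
           (T 0 + T 3) + J (T 1 + T 2)])"
proof -
  interpret complex_clifford_algebra scale gen p q by fact
  note n = assms(2,3)
  \<comment> \<open>For low dimensions these rules reduce both sides to graded spaces over explicit
    sets of pairs.\<close>
  note evaluate = rank_space_eq graded_space_Un scale_ii_graded_space scale_unit_graded_space
    rank_coeff_def insert_commute
  have upt: "[0..<0 + 1] = [0 :: nat]" "[0..<1 + 1] = [0, 1 :: nat]" "[0..<2 + 1] = [0, 1, 2 :: nat]"
    "[0..<3 + 1] = [0, 1, 2, 3 :: nat]" "[0..<4 + 1] = [0, 1, 2, 3, 4 :: nat]"
    "[0..<5 + 1] = [0, 1, 2, 3, 4, 5 :: nat]"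
    by (simp_all add: eval_nat_numeral)
  \<comment> \<open>The ranks are listed up to \<open>k\<close>, whereas a quaternion type runs up
    to \<open>n\<close>; the two agree when no rank above \<open>k\<close> has an admissible
    residue.\<close>
  have js: "set (filter Q [0..<k + 1]) = {j. j \<le> p + q \<and> j mod 4 \<in> S}"
    if Q: "\<And>j. Q j \<longleftrightarrow> j mod 4 \<in> S" and k: "k \<le> n" "\<forall>j\<in>{k<..n}. j mod 4 \<notin> S" for Q k S
  proof -
    have "set (filter Q [0..<k + 1]) = {j. j \<le> k \<and> j mod 4 \<in> S}"
      by (auto simp: Q simp del: upt_Suc)
    also have "\<dots> = {j. j \<le> n \<and> j mod 4 \<in> S}" using k by force
    finally show ?thesis by (simp only: assms(2))
  qed
  have interval: "{k<..Suc k} = {Suc k}" "{k<..Suc (Suc k)} = {Suc k, Suc (Suc k)}"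
    "{k<..Suc (Suc (Suc k))} = {Suc k, Suc (Suc k), Suc (Suc (Suc k))}" for k :: nat
    by auto
  have even_mod_4: "even j \<longleftrightarrow> j mod 4 \<in> {0, 2}" for j :: nat by (simp; presburger)
  have L7: "set (filter even [0..<k + 1]) = {j. j \<le> p + q \<and> j mod 4 \<in> {0, 2}}"
    if k: "even k \<and> n \<in> {k, k + 1}" for k
  proof (rule js[OF even_mod_4])
    show "\<forall>j\<in>{k<..n}. j mod 4 \<notin> {0, 2}"
      using k unfolding even_mod_4[symmetric] by (auto simp: interval)
  qed (use k in auto)
  have L9: "set (filter (\<lambda>j. j mod 4 \<in> {0, 3}) [0..<k + 1]) = {j. j \<le> p + q \<and> j mod 4 \<in> {0, 3}}"
    if k: "k mod 4 \<in> {0, 3} \<and> (even k \<longrightarrow> n \<in> {k, k + 1, k + 2}) \<and> (odd k \<longrightarrow> n = k)" for k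
  proof (rule js[OF refl])
    \<comment> \<open>Only residue 0 of \<open>k\<close> leaves room above \<open>k\<close>, and the
      next two ranks then have residues 1 and 2.\<close>
    have "n = k \<or> k mod 4 = 0 \<and> (n = k + 1 \<or> n = k + 2)"
      using k even_mod_4[of k] by auto
    then show "\<forall>j\<in>{k<..n}. j mod 4 \<notin> {0, 3}"
      by (elim disjE conjE) (simp_all add: interval mod_Suc)
  qed (use k in auto)
  have L10: "set (filter (\<lambda>j. j mod 4 \<in> {0, 1}) [0..<k + 1]) = {j. j \<le> p + q \<and> j mod 4 \<in> {0, 1}}"
    if k: "k mod 4 \<in> {0, 1} \<and> (odd k \<longrightarrow> n \<in> {k, k + 1, k + 2}) \<and> (even k \<longrightarrow> n = k)" for k
  proof (rule js[OF refl])
    \<comment> \<open>Only residue 1 of \<open>k\<close> leaves room above \<open>k\<close>, and the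
      next two ranks then have residues 2 and 3.\<close>
    have "n = k \<or> k mod 4 = 1 \<and> (n = k + 1 \<or> n = k + 2)"
      using k even_mod_4[of k] by auto
    then show "\<forall>j\<in>{k<..n}. j mod 4 \<notin> {0, 1}"
      by (elim disjE conjE) (simp_all add: interval mod_Suc)
  qed (use k in auto)
  have L11: "set (filter (\<lambda>j. j mod 4 = 0) [0..<k + 1]) = {j. j \<le> p + q \<and> j mod 4 \<in> {0}}"
    if k: "k mod 4 = 0 \<and> n \<in> {k, k + 1, k + 2, k + 3}" for k
  proof (rule js)
    have "k mod 4 = 0" "n = k \<or> n = k + 1 \<or> n = k + 2 \<or> n = k + 3"
      using k by auto
    then show "\<forall>j\<in>{k<..n}. j mod 4 \<notin> {0}"
      by (elim disjE) (simp_all add: interval mod_Suc numeral_3_eq_3)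
  qed (use k in auto)
  have L12: "set [0..<n + 1] = {j. j \<le> p + q \<and> j mod 4 \<in> {0..3}}"
    using n(1) by (auto simp: less_Suc_eq_le simp del: upt_Suc)
  note periodic7 = periodic_lists[OF _ L7 rank_coeff_phase(1) _ refl]
    and periodic9 = periodic_lists[OF _ L9 rank_coeff_phase(1) _ refl]
    and periodic10 = periodic_lists[OF _ L10 rank_coeff_phase(2) _ refl]
    and periodic11 = periodic_real_subalgebra[OF _ L11 _ refl]
      periodic_complex_subalgebra[OF _ L11 _ refl]
    and periodic12 = periodic_real_subalgebra[OF _ L12 _ refl]
      periodic_subalgebra[OF _ L12 rank_coeff_phase(1) _ refl]
      periodic_subalgebra[OF _ L12 rank_coeff_phase(3) _ refl]
      periodic_subalgebra[OF _ L12 rank_coeff_phase(2) _ refl]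
  have range_4: "{0..3} = {0, 1, 2, 3 :: nat}" by auto
  \<comment> \<open>Each periodic item with a bound \<open>k\<close> contributes closure, the
    evaluated sums and its low dimensions as separate goals.\<close>
  show ?thesis
    unfolding Let_def
  proof (intro conjI allI impI, goal_cases)
    case 1
    show ?case by (rule one_rank_lists)
  next
    case 2
    then show ?case by (intro two_rank_lists) auto
  next
    case 3
    then show ?case using n by (intro two_rank_lists) auto
  next
    case 4
    then show ?case using n by (intro two_rank_lists) auto
  next
    case 5
    then show ?case unfolding n by (intro three_rank_lists) auto
  next
    case 6
    then show ?case unfolding n by (intro three_rank_lists) auto
  next
    case (7 k)
    show ?case by (rule periodic7(1)[OF _ 7(1)]) simp_all
  next
    case (8 k)
    show ?case
      by (subst periodic7(2)[OF _ 8(1)])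
        (simp_all add: quaternion_simps UNIV_bool insert_commute)
  next
    case (9 k)
    \<comment> \<open>In dimension 1, as in the later low dimensions, the hypotheses leave a single
      value of \<open>k\<close>, and both lists are computed outright.\<close>
    then have k: "k = 0" by auto
    show ?case using 9 unfolding k upt by (simp add: evaluate)
  next
    case (10 k)
    then have k: "k = 2" by auto
    show ?case using 10 unfolding k upt by (simp add: evaluate)
  next
    case (11 k)
    then have k: "k = 2" by auto
    show ?case using 11 unfolding k upt by (simp add: evaluate)
  next
    case 12
    then show ?case unfolding n by (intro four_rank_lists) auto
  next
    case (13 k)
    show ?case by (rule periodic9(1)[OF _ 13(1)]) simp_all
  next
    case (14 k)
    show ?case
      by (subst periodic9(2)[OF _ 14(1)])
        (simp_all add: quaternion_simps UNIV_bool insert_commute)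
  next
    case (15 k)
    then have k: "k = 0" by auto
    show ?case using 15 unfolding k upt by (simp add: evaluate)
  next
    case (16 k)
    then have k: "k = 3" by auto
    show ?case using 16 unfolding k upt by (simp add: evaluate)
  next
    case (17 k)
    then have k: "k = 4" by auto
    show ?case using 17 unfolding k upt by (simp add: evaluate)
  next
    case (18 k)
    show ?case by (rule periodic10(1)[OF _ 18(1)]) simp_all
  next
    case (19 k)
    show ?case
      by (subst periodic10(2)[OF _ 19(1)])
        (simp_all add: quaternion_simps UNIV_bool insert_commute)
  next
    case (20 k)
    then have k: "k = 1" by auto
    show ?case using 20 unfolding k upt by (simp add: evaluate)
  next
    case (21 k)
    then have k: "k = 4" by auto
    show ?case using 21 unfolding k upt by (simp add: evaluate)
  next
    case (22 k)
    then have k: "k = 5" by auto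
    show ?case using 22 unfolding k upt by (simp add: evaluate)
  next
    case (23 k)
    show ?case using periodic11[OF _ 23(1)] by simp
  next
    case (24 k)
    show ?case using periodic11[OF _ 24(1)]
      by (simp add: quaternion_simps UNIV_bool insert_commute)
  next
    case (25 k)
    then have k: "k = 0" by auto
    show ?case using 25 unfolding k upt by (simp add: evaluate)
  next
    case (26 k)
    then have k: "k = 4" by auto
    show ?case using 26 unfolding k upt by (simp add: evaluate)
  next
    case (27 k)
    then have k: "k = 4" by auto
    show ?case using 27 unfolding k upt by (simp add: evaluate)
  next
    case 28
    show ?case using periodic12 by (simp add: range_4)
  next
    case 29
    show ?case using periodic12
      by (simp add: range_4 real_clifford_eq quaternion_simps insert_commute)
  qed
qed

end
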